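(* There are Bieberbach groups $G$ of finite generalized exponent satisfying any of the following properties: (1) for any integer $l\ge2$: $G$ is solvable of derived length $l$; (2) $G$ is of arbitrarily large generalized exponent (that is, for every positive integer $N$ there is a Bieberbach group $G$ with $N\le \exp_{\bullet}(G)<\infty$); (3) $G$ is non-solvable.
   Context: A $d$-dimensional crystallographic group is a discrete and cocompact subgroup of $\operatorname{Iso}(\mathbb{R}^d)=O(d)\ltimes\mathbb{R}^d$, the isometry group of $d$-dimensional Euclidean space. A Bieberbach group is a torsion-free crystallographic group (of some dimension $d$). For a conjugacy class $C$ of a group $G$ and $k\ge1$, put $C^k=\{c_1\cdots c_k\mid c_i\in C\}$. The generalized exponent $\exp_{\bullet}(G)$ is the smallest positive integer $k$ such that $1\in C^k$ for all conjugacy classes $C$ of $G$; $G$ has finite generalized exponent if such a $k$ exists. *)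

theory Defs
  imports
    "HOL-Analysis.Function_Topology"
    "HOL-Algebra.Solvable_Groups"
    "Jordan_Normal_Form.Determinant"
begin

text \<open>The dimension is existentially quantified in the notion of a Bieberbach group, so it cannot
  be a type. Euclidean d-space is therefore \<^term>\<open>carrier_vec d :: real vec set\<close>.\<close>

type_synonym isometry = "real mat \<times> real vec"

text \<open>The library constant \<^const>\<open>orthogonal_mat\<close> only asks for pairwise orthogonal nonzero
  columns, so O(d) is defined here.\<close>

definition orthogonal_group_set :: "nat \<Rightarrow> real mat set" where
  "orthogonal_group_set d = {A \<in> carrier_mat d d. transpose_mat A * A = 1\<^sub>m d}"

text \<open>The pair \<open>(A, v)\<close> stands for the isometry \<open>x \<mapsto> A x + v\<close>.\<close>

definition Iso :: "nat \<Rightarrow> isometry monoid" where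
  "Iso d = \<lparr>carrier = orthogonal_group_set d \<times> carrier_vec d,
            monoid.mult = (\<lambda>(A, v) (B, w). (A * B, A *\<^sub>v w + v)),
            one = (1\<^sub>m d, 0\<^sub>v d)\<rparr>"

text \<open>The topology of O(d) x R^d, that is, the coarsest one making all matrix and vector entries
  continuous. The type \<^typ>\<open>real mat\<close> carries no topology; entries outside the index range are
  replaced by 0, and the target function space has the product topology.\<close>

definition entries :: "nat \<Rightarrow> isometry \<Rightarrow> (nat \<Rightarrow> nat \<Rightarrow> real) \<times> (nat \<Rightarrow> real)" where
  "entries d = (\<lambda>(A, v). ((\<lambda>i j. if i < d \<and> j < d then A $$ (i, j) else 0),
                          (\<lambda>i. if i < d then v $ i else 0)))"

definition Iso_topology :: "nat \<Rightarrow> isometry topology" where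
  "Iso_topology d = pullback_topology (carrier (Iso d)) (entries d) euclidean"

definition discrete_in_Iso :: "nat \<Rightarrow> isometry set \<Rightarrow> bool" where
  "discrete_in_Iso d H \<longleftrightarrow> subtopology (Iso_topology d) H = discrete_topology H"

text \<open>A quotient map determines the topology of its target, so \<open>Q\<close> is the coset space of \<open>H\<close>
  with the quotient topology (see \<open>coset_space_exists\<close> and \<open>coset_space_unique\<close> below).\<close>

definition cocompact_in_Iso :: "nat \<Rightarrow> isometry set \<Rightarrow> bool" where
  "cocompact_in_Iso d H \<longleftrightarrow>
     (\<exists>Q. quotient_map (Iso_topology d) Q (\<lambda>g. H #>\<^bsub>Iso d\<^esub> g) \<and> compact_space Q)"

definition crystallographic_group :: "nat \<Rightarrow> isometry monoid \<Rightarrow> bool" where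
  "crystallographic_group d G \<longleftrightarrow>
     (\<exists>H. subgroup H (Iso d) \<and> discrete_in_Iso d H \<and> cocompact_in_Iso d H \<and>
          G = (Iso d)\<lparr>carrier := H\<rparr>)"

definition torsion_free :: "('a, 'b) monoid_scheme \<Rightarrow> bool" where
  "torsion_free G \<longleftrightarrow>
     (\<forall>x \<in> carrier G. \<forall>n::nat. n > 0 \<longrightarrow> x [^]\<^bsub>G\<^esub> n = \<one>\<^bsub>G\<^esub> \<longrightarrow> x = \<one>\<^bsub>G\<^esub>)"

definition Bieberbach_group :: "isometry monoid \<Rightarrow> bool" where
  "Bieberbach_group G \<longleftrightarrow> (\<exists>d. crystallographic_group d G) \<and> torsion_free G"

definition conjugacy_classes :: "('a, 'b) monoid_scheme \<Rightarrow> 'a set set" where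
  "conjugacy_classes G =
     (\<lambda>x. (\<lambda>g. g \<otimes>\<^bsub>G\<^esub> x \<otimes>\<^bsub>G\<^esub> inv\<^bsub>G\<^esub> g) ` carrier G) ` carrier G"

definition set_power :: "('a, 'b) monoid_scheme \<Rightarrow> 'a set \<Rightarrow> nat \<Rightarrow> 'a set" where
  "set_power G C k = {foldr (monoid.mult G) cs \<one>\<^bsub>G\<^esub> | cs. length cs = k \<and> set cs \<subseteq> C}"

definition is_generalized_period :: "('a, 'b) monoid_scheme \<Rightarrow> nat \<Rightarrow> bool" where
  "is_generalized_period G k \<longleftrightarrow>
     k > 0 \<and> (\<forall>C \<in> conjugacy_classes G. \<one>\<^bsub>G\<^esub> \<in> set_power G C k)"

definition finite_generalized_exponent :: "('a, 'b) monoid_scheme \<Rightarrow> bool" where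
  "finite_generalized_exponent G \<longleftrightarrow> (\<exists>k. is_generalized_period G k)"

text \<open>Meaningful only under \<^const>\<open>finite_generalized_exponent\<close>.\<close>

definition generalized_exponent :: "('a, 'b) monoid_scheme \<Rightarrow> nat" where
  "generalized_exponent G = (LEAST k. is_generalized_period G k)"

text \<open>Meaningful only for solvable groups.\<close>

definition derived_length :: "('a, 'b) monoid_scheme \<Rightarrow> nat" where
  "derived_length G = (LEAST n. (derived G ^^ n) (carrier G) = {\<one>\<^bsub>G\<^esub>})"

lemma orthogonal_mult_transpose:
  assumes "A \<in> orthogonal_group_set d"
  shows "A * transpose_mat A = 1\<^sub>m d"
proof -
  have A: "A \<in> carrier_mat d d" and t: "transpose_mat A * A = 1\<^sub>m d"
    using assms by (auto simp: orthogonal_group_set_def)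
  show ?thesis by (rule mat_mult_left_right_inverse[OF transpose_carrier_mat[THEN iffD2, OF A] A t])
qed

lemma group_Iso: "group (Iso d)"
proof (rule groupI)
  fix x y assume "x \<in> carrier (Iso d)" "y \<in> carrier (Iso d)"
  then obtain A v B w where xy: "x = (A, v)" "y = (B, w)"
    and c: "A \<in> carrier_mat d d" "B \<in> carrier_mat d d" "v \<in> carrier_vec d" "w \<in> carrier_vec d"
    and t: "transpose_mat A * A = 1\<^sub>m d" "transpose_mat B * B = 1\<^sub>m d"
    by (auto simp: Iso_def orthogonal_group_set_def)
  have "transpose_mat (A * B) * (A * B) = (transpose_mat B * transpose_mat A) * (A * B)"
    using c by (simp add: transpose_mult)
  also have "\<dots> = transpose_mat B * ((transpose_mat A * A) * B)"
    using c by (simp only: assoc_mult_mat[of _ d d _ d _ d] mult_carrier_mat transpose_carrier_mat)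
  also have "\<dots> = 1\<^sub>m d" using c t by simp
  finally show "x \<otimes>\<^bsub>Iso d\<^esub> y \<in> carrier (Iso d)"
    using c xy by (auto simp: Iso_def orthogonal_group_set_def)
next
  show "\<one>\<^bsub>Iso d\<^esub> \<in> carrier (Iso d)"
    by (auto simp: Iso_def orthogonal_group_set_def)
next
  fix x y z assume "x \<in> carrier (Iso d)" "y \<in> carrier (Iso d)" "z \<in> carrier (Iso d)"
  then obtain A v B w C u where xyz: "x = (A, v)" "y = (B, w)" "z = (C, u)"
    and c: "A \<in> carrier_mat d d" "B \<in> carrier_mat d d" "C \<in> carrier_mat d d"
      "v \<in> carrier_vec d" "w \<in> carrier_vec d" "u \<in> carrier_vec d"
    by (auto simp: Iso_def orthogonal_group_set_def)
  have "A *\<^sub>v (B *\<^sub>v u + w) + v = (A *\<^sub>v (B *\<^sub>v u) + A *\<^sub>v w) + v"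
    using c by (simp only: mult_add_distrib_mat_vec[of _ d d] mult_mat_vec_carrier)
  also have "\<dots> = A *\<^sub>v (B *\<^sub>v u) + (A *\<^sub>v w + v)"
    using c by (intro assoc_add_vec[of _ d] mult_mat_vec_carrier)
  also have "A *\<^sub>v (B *\<^sub>v u) = (A * B) *\<^sub>v u"
    using c by (intro assoc_mult_mat_vec[symmetric])
  finally have "A *\<^sub>v (B *\<^sub>v u + w) + v = (A * B) *\<^sub>v u + (A *\<^sub>v w + v)" .
  moreover have "A * B * C = A * (B * C)"
    using c by (intro assoc_mult_mat)
  ultimately show "x \<otimes>\<^bsub>Iso d\<^esub> y \<otimes>\<^bsub>Iso d\<^esub> z = x \<otimes>\<^bsub>Iso d\<^esub> (y \<otimes>\<^bsub>Iso d\<^esub> z)"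
    unfolding xyz Iso_def monoid.simps prod.case by (simp only:)
next
  fix x assume "x \<in> carrier (Iso d)"
  then show "\<one>\<^bsub>Iso d\<^esub> \<otimes>\<^bsub>Iso d\<^esub> x = x"
    by (auto simp: Iso_def orthogonal_group_set_def)
next
  fix x assume "x \<in> carrier (Iso d)"
  then obtain A v where x: "x = (A, v)" and A: "A \<in> orthogonal_group_set d"
    and c: "A \<in> carrier_mat d d" "v \<in> carrier_vec d" and t: "transpose_mat A * A = 1\<^sub>m d"
    by (auto simp: Iso_def orthogonal_group_set_def)
  let ?y = "(transpose_mat A, - (transpose_mat A *\<^sub>v v))"
  have "?y \<in> carrier (Iso d)"
    using c orthogonal_mult_transpose[OF A] by (auto simp: Iso_def orthogonal_group_set_def)
  moreover have "?y \<otimes>\<^bsub>Iso d\<^esub> x = \<one>\<^bsub>Iso d\<^esub>"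
    using c t x by (auto simp: Iso_def uminus_r_inv_vec)
  ultimately show "\<exists>y\<in>carrier (Iso d). y \<otimes>\<^bsub>Iso d\<^esub> x = \<one>\<^bsub>Iso d\<^esub>" by blast
qed

lemma topspace_Iso_topology: "topspace (Iso_topology d) = carrier (Iso d)"
  by (simp add: Iso_topology_def topspace_pullback_topology)

lemma coset_space_exists: "\<exists>Q. quotient_map (Iso_topology d) Q (\<lambda>g. H #>\<^bsub>Iso d\<^esub> g)"
proof -
  have *: "\<exists>Q. quotient_map X Q f" for X :: "'a topology" and f :: "'a \<Rightarrow> 'b"
  proof -
    define pre where "pre U = {x \<in> topspace X. f x \<in> U}" for U
    define P where "P U \<longleftrightarrow> U \<subseteq> f ` topspace X \<and> openin X (pre U)" for U
    have "P (S \<inter> T)" if "P S" "P T" for S T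
    proof -
      have "pre (S \<inter> T) = pre S \<inter> pre T" by (auto simp: pre_def)
      then show ?thesis using that by (simp add: P_def openin_Int le_infI1)
    qed
    moreover have "P (\<Union>K)" if "\<forall>S\<in>K. P S" for K
    proof -
      have "pre (\<Union>K) = \<Union>(pre ` K)" by (auto simp: pre_def)
      moreover have "openin X (\<Union>(pre ` K))" using that by (intro openin_Union) (auto simp: P_def)
      ultimately show ?thesis using that by (simp add: P_def Sup_least)
    qed
    ultimately have "istopology P" by (simp add: istopology_def)
    then have open_iff: "openin (topology P) = P" by (rule topology_inverse')
    have "pre (f ` topspace X) = topspace X" by (auto simp: pre_def)
    then have "P (f ` topspace X)" by (simp add: P_def)
    then have "topspace (topology P) = f ` topspace X"
      by (intro equalityI) (auto simp only: topspace_def open_iff P_def)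
    then have "quotient_map X (topology P) f"
      by (simp add: quotient_map_def open_iff P_def pre_def)
    then show ?thesis by (rule exI)
  qed
  show ?thesis by (rule *)
qed

lemma coset_space_unique:
  assumes Q: "quotient_map X Q f" and Q': "quotient_map X Q' f"
  shows "Q = Q'"
proof -
  have surj: "f ` topspace X = topspace Q" "f ` topspace X = topspace Q'"
    using Q Q' by (simp_all only: quotient_map_def)
  have "openin Q U \<longleftrightarrow> openin Q' U" for U
  proof (cases "U \<subseteq> f ` topspace X")
    case True
    have "openin X {x \<in> topspace X. f x \<in> U} \<longleftrightarrow> openin Q U"
      using Q True[unfolded surj(1)] by (simp only: quotient_map_def)
    moreover have "openin X {x \<in> topspace X. f x \<in> U} \<longleftrightarrow> openin Q' U"
      using Q' True[unfolded surj(2)] by (simp only: quotient_map_def)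
    ultimately show ?thesis by (simp only:)
  next
    case False
    then have "\<not> openin Q U" "\<not> openin Q' U"
      using openin_subset[of Q U] openin_subset[of Q' U] surj by metis+
    then show ?thesis by (simp only:)
  qed
  then show ?thesis unfolding topology_eq by blast
qed

end

theory Submission
  imports Defs "HOL-Algebra.Sym_Groups" "HOL-Algebra.Weak_Morphisms"
    "HOL-Algebra.Elementary_Groups" "HOL-Algebra.Multiplicative_Group"
begin

text \<open>Let a finite group \<open>P\<close> act on the torus \<open>(\<real>/N\<int>)\<^sup>d\<close> by signed permutations of the coordinates
  combined with integer shifts. If the action is free, the lifts of \<open>P\<close> to isometries of \<open>\<real>\<^sup>d\<close> form a
  Bieberbach group \<open>G\<close> with \<open>G/N\<int>\<^sup>d = P\<close>. If the linear parts fix no nonzero vector they sum to zero,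
  and then \<open>G\<close> has finite generalized exponent: for \<open>n = |P|\<close> the power \<open>g\<^sup>n\<close> is a translation, and the
  product of its conjugates under lifts of all elements of \<open>P\<close> is trivial.

  Such an action is induced from actions of dihedral subgroups \<open>\<langle>p, s\<rangle>\<close> on the circle, with \<open>p\<close> rotating and \<open>s\<close>
  reflecting; it is free as soon as every nontrivial element of \<open>P\<close> has a power occurring as such a \<open>p\<close>.
  This holds for \<open>P = Q \<times> C\<^sub>2\<close> when \<open>Q\<close> is a nontrivial 2-group or a symmetric group.
  Since \<open>G\<close> maps onto \<open>Q\<close>, symmetric groups \<open>Q\<close> give non-solvable \<open>G\<close> and cyclic 2-groups \<open>Q\<close> give large
  generalized exponents; a 2-group \<open>Q\<close> of derived length \<open>l - 1\<close> gives \<open>G\<close> of derived length \<open>l\<close>.\<close>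

section \<open>Discreteness and cocompactness in the isometry group\<close>

lemma carrier_Iso_iff:
  "(A, v) \<in> carrier (Iso d) \<longleftrightarrow> A \<in> carrier_mat d d \<and> transpose_mat A * A = 1\<^sub>m d \<and> v \<in> carrier_vec d"
  by (auto simp: Iso_def orthogonal_group_set_def)

lemma mult_Iso: "(A, v) \<otimes>\<^bsub>Iso d\<^esub> (B, w) = (A * B, A *\<^sub>v w + v)"
  by (simp add: Iso_def)

lemma one_Iso: "\<one>\<^bsub>Iso d\<^esub> = (1\<^sub>m d, 0\<^sub>v d)"
  by (simp add: Iso_def)

lemma transpose_mult_self_eq_one_iff:
  fixes A :: "real mat"
  assumes "A \<in> carrier_mat d d"
  shows "transpose_mat A * A = 1\<^sub>m d \<longleftrightarrow>
    (\<forall>j\<in>{..<d}. \<forall>k\<in>{..<d}. (\<Sum>i<d. A $$ (i, j) * A $$ (i, k)) = (if j = k then 1 else 0))"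
proof -
  have "(transpose_mat A * A) $$ (j, k) = (\<Sum>i<d. A $$ (i, j) * A $$ (i, k))" if "j < d" "k < d" for j k
    using assms that by (auto simp: scalar_prod_def atLeast0LessThan intro!: sum.cong)
  then show ?thesis
    using assms by (auto simp: mat_eq_iff)
qed

lemma continuous_on_entries:
  fixes S :: "((nat \<Rightarrow> nat \<Rightarrow> real) \<times> (nat \<Rightarrow> real)) set"
  shows "continuous_on S (\<lambda>fu. fst fu i j)" "continuous_on S (\<lambda>fu. snd fu i)"
  using continuous_on_product_then_coordinatewise[of S "\<lambda>fu. fst fu i" j]
    continuous_on_product_then_coordinatewise[of S fst i]
    continuous_on_product_then_coordinatewise[of S snd i]
    continuous_on_fst[OF continuous_on_id] continuous_on_snd[OF continuous_on_id] by blast+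

text \<open>Two integers at distance less than 1 agree, so the open unit box around the entries of
  one element of \<open>H\<close> contains no other element of \<open>H\<close>.\<close>

lemma discrete_in_Iso_if_integral:
  assumes sub: "H \<subseteq> carrier (Iso d)"
    and int: "\<And>A v i j. (A, v) \<in> H \<Longrightarrow> i < d \<Longrightarrow> j < d \<Longrightarrow> A $$ (i, j) \<in> \<int> \<and> v $ i \<in> \<int>"
  shows "discrete_in_Iso d H"
proof -
  have "openin (subtopology (Iso_topology d) H) {x}" if x: "x \<in> H" for x
  proof -
    obtain A v where xe: "x = (A, v)" by (cases x)
    define V :: "((nat \<Rightarrow> nat \<Rightarrow> real) \<times> (nat \<Rightarrow> real)) set" where
      "V = (\<Inter>i\<in>{..<d}. \<Inter>j\<in>{..<d}. {fu. \<bar>fst fu i j - A $$ (i, j)\<bar> < 1} \<inter> {fu. \<bar>snd fu i - v $ i\<bar> < 1})"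
    have "open V" unfolding V_def
      by (intro open_INT open_Int ballI finite_lessThan open_Collect_less continuous_intros continuous_on_entries)
    moreover have "{x} = (entries d -` V \<inter> carrier (Iso d)) \<inter> H"
    proof (intro equalityI subsetI)
      fix y assume "y \<in> {x}"
      then show "y \<in> (entries d -` V \<inter> carrier (Iso d)) \<inter> H"
        using x sub by (auto simp: V_def entries_def xe)
    next
      fix y assume y: "y \<in> (entries d -` V \<inter> carrier (Iso d)) \<inter> H"
      obtain B w where ye: "y = (B, w)" by (cases y)
      have lt: "\<bar>B $$ (i, j) - A $$ (i, j)\<bar> < 1" "\<bar>w $ i - v $ i\<bar> < 1" if "i < d" "j < d" for i j
      proof -
        have "entries d y \<in> {fu. \<bar>fst fu i j - A $$ (i, j)\<bar> < 1} \<inter> {fu. \<bar>snd fu i - v $ i\<bar> < 1}"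
          using y that unfolding V_def by blast
        then show "\<bar>B $$ (i, j) - A $$ (i, j)\<bar> < 1" "\<bar>w $ i - v $ i\<bar> < 1"
          using that by (simp_all add: entries_def ye)
      qed
      have eqI: "a = b" if "a \<in> \<int>" "b \<in> \<int>" "\<bar>a - b\<bar> < 1" for a b :: real
        using that by (metis Ints_diff Ints_nonzero_abs_less1 eq_iff_diff_eq_0)
      have "B $$ (i, j) = A $$ (i, j)" "w $ i = v $ i" if "i < d" "j < d" for i j
        using eqI lt[OF that] int[OF _ that] x y unfolding xe ye by blast+
      moreover have "(A, v) \<in> carrier (Iso d)" "(B, w) \<in> carrier (Iso d)"
        using x y sub by (auto simp: xe ye)
      ultimately have "B = A" "w = v"
        unfolding carrier_Iso_iff by (intro eq_matI eq_vecI; force)+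
      then show "y \<in> {x}" by (simp add: xe ye)
    qed
    ultimately show ?thesis
      unfolding openin_subtopology Iso_topology_def openin_pullback_topology open_openin[symmetric] by blast
  qed
  then show ?thesis
    unfolding discrete_in_Iso_def using sub
    by (intro sym[OF iffD2[OF discrete_topology_unique]]) (auto simp: topspace_Iso_topology)
qed

text \<open>\<open>entries d\<close> identifies this set with a subset \<open>C\<close> of a product
  of intervals, cut out by closed conditions: zero padding, the bound \<open>b\<close>, and
  orthonormal columns. The inverse map \<open>g\<close> carries compactness back.\<close>

lemma compactin_Iso_box:
  "compactin (Iso_topology d) {(A, v) \<in> carrier (Iso d). \<forall>i<d. v $ i \<in> {0..b}}"
proof -
  \<comment> \<open>\<open>max b 0\<close> keeps the padding value 0 inside the interval when
    \<open>b\<close> is negative; the bound \<open>b\<close> itself is imposed in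
    \<open>C\<close>.\<close>
  define B where "B = (Pi\<^sub>E UNIV (\<lambda>i::nat. Pi\<^sub>E UNIV (\<lambda>j::nat. {-1..1::real}))) \<times> Pi\<^sub>E UNIV (\<lambda>i::nat. {0..max b 0})"
  define C where "C = B \<inter> {fu. (\<forall>i j. \<not> (i < d \<and> j < d) \<longrightarrow> fst fu i j = 0) \<and> (\<forall>i. \<not> i < d \<longrightarrow> snd fu i = 0) \<and> (\<forall>i. i < d \<longrightarrow> snd fu i \<le> b) \<and>
     (\<forall>j k. j < d \<longrightarrow> k < d \<longrightarrow> (\<Sum>i<d. fst fu i j * fst fu i k) = (if j = k then 1 else 0))}"
  have "compact B"
  proof -
    have box: "compact (Pi\<^sub>E UNIV X)" if "\<And>i. compact (X i)" for X :: "nat \<Rightarrow> 'b::topological_space set"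
      using that compactin_PiE[of "\<lambda>_. euclidean" UNIV X] by (simp add: euclidean_product_topology)
    show ?thesis unfolding B_def by (intro compact_Times box compact_Icc)
  qed
  have "compact C"
    unfolding C_def using \<open>compact B\<close>
    by (intro compact_Int_closed closed_Collect_conj closed_Collect_all closed_Collect_imp
          closed_Collect_eq closed_Collect_le open_Collect_const continuous_intros continuous_on_entries)
  define g where "g = (\<lambda>(f :: nat \<Rightarrow> nat \<Rightarrow> real, u :: nat \<Rightarrow> real). (mat d d (\<lambda>(i, j). f i j), vec d u))"
  have eg: "entries d (g fu) = fu" if "fu \<in> C" for fu
    using that by (cases fu) (auto simp: entries_def g_def C_def fun_eq_iff)
  have gc: "g fu \<in> carrier (Iso d)" if "fu \<in> C" for fu
  proof -
    have "mat d d (\<lambda>(i, j). fst fu i j) \<in> carrier_mat d d" by simp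
    then show ?thesis
      using that unfolding g_def split_beta fst_conv snd_conv carrier_Iso_iff
      by (subst transpose_mult_self_eq_one_iff) (auto simp: C_def)
  qed
  have "continuous_map (subtopology euclidean C) (Iso_topology d) g"
    unfolding Iso_topology_def
  proof (rule continuous_map_pullback')
    show "continuous_map (top_of_set C) euclidean (entries d \<circ> g)"
      by (rule continuous_map_eq[of _ _ id]) (auto simp: eg continuous_map_from_subtopology)
    show "topspace (top_of_set C) \<subseteq> g -` carrier (Iso d)" using gc by auto
  qed
  moreover have "compactin (subtopology euclidean C) C"
    using \<open>compact C\<close> by (simp add: compactin_subtopology)
  ultimately have "compactin (Iso_topology d) (g ` C)" by (rule image_compactin[rotated])
  also have "g ` C = {(A, v) \<in> carrier (Iso d). \<forall>i<d. v $ i \<in> {0..b}}"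
  proof (intro equalityI subsetI)
    fix x assume "x \<in> g ` C"
    then obtain fu where fu: "fu \<in> C" "x = g fu" by auto
    then show "x \<in> {(A, v) \<in> carrier (Iso d). \<forall>i<d. v $ i \<in> {0..b}}"
      using gc[OF fu(1)] by (auto simp: g_def C_def B_def PiE_iff split_beta)
  next
    fix x assume "x \<in> {(A, v) \<in> carrier (Iso d). \<forall>i<d. v $ i \<in> {0..b}}"
    then obtain A v where x: "x = (A, v)" and A: "A \<in> carrier_mat d d" and t: "transpose_mat A * A = 1\<^sub>m d"
      and v: "v \<in> carrier_vec d" "\<And>i. i < d \<Longrightarrow> v $ i \<in> {0..b}"
      by (auto simp: carrier_Iso_iff)
    have o: "\<forall>j\<in>{..<d}. \<forall>k\<in>{..<d}. (\<Sum>i<d. A $$ (i, j) * A $$ (i, k)) = (if j = k then 1 else 0)"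
      using transpose_mult_self_eq_one_iff[OF A] t by blast
    have "\<bar>A $$ (i, j)\<bar> \<le> 1" if "i < d" "j < d" for i j
    proof -
      have "(A $$ (i, j))\<^sup>2 \<le> (\<Sum>i<d. A $$ (i, j) * A $$ (i, j))"
        using member_le_sum[of i "{..<d}" "\<lambda>i. A $$ (i, j) * A $$ (i, j)"] that by (simp add: power2_eq_square)
      also have "\<dots> = 1" using o that by auto
      finally show ?thesis by (simp add: abs_square_le_1)
    qed
    then have "entries d x \<in> C"
      using o v by (fastforce simp: x C_def B_def entries_def PiE_iff abs_le_iff)
    moreover have "g (entries d x) = x"
      using A v by (auto simp: g_def entries_def x)
    ultimately show "x \<in> g ` C" by force
  qed
  finally show ?thesis .
qed

text \<open>Left multiplication by \<open>(1\<^sub>m d, w)\<close> adds \<open>w\<close> to the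
  vector part and keeps the right coset of \<open>H\<close>. Every coset therefore meets the compact
  box, and the coset space is a continuous image of that box.\<close>

lemma cocompact_in_Iso_if_translations:
  assumes H: "subgroup H (Iso d)"
    and t: "\<And>v. v \<in> carrier_vec d \<Longrightarrow> \<exists>w. (1\<^sub>m d, w) \<in> H \<and> (\<forall>i<d. (v + w) $ i \<in> {0..b})"
  shows "cocompact_in_Iso d H"
proof -
  interpret group "Iso d" by (rule group_Iso)
  obtain Q where Q: "quotient_map (Iso_topology d) Q (\<lambda>g. H #>\<^bsub>Iso d\<^esub> g)"
    using coset_space_exists by blast
  let ?K = "{(A, v) \<in> carrier (Iso d). \<forall>i<d. v $ i \<in> {0..b}}"
  have "compactin Q ((\<lambda>g. H #>\<^bsub>Iso d\<^esub> g) ` ?K)"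
    by (rule image_compactin[OF compactin_Iso_box quotient_imp_continuous_map[OF Q]])
  moreover have "(\<lambda>g. H #>\<^bsub>Iso d\<^esub> g) ` ?K = topspace Q"
  proof -
    have "H #>\<^bsub>Iso d\<^esub> x \<in> (\<lambda>g. H #>\<^bsub>Iso d\<^esub> g) ` ?K" if x: "x \<in> carrier (Iso d)" for x
    proof -
      obtain A v where xe: "x = (A, v)" by (cases x)
      with x have c: "A \<in> carrier_mat d d" "v \<in> carrier_vec d" by (auto simp: carrier_Iso_iff)
      obtain w where w: "(1\<^sub>m d, w) \<in> H" "\<forall>i<d. (v + w) $ i \<in> {0..b}" using t[OF c(2)] by blast
      let ?y = "(1\<^sub>m d, w) \<otimes>\<^bsub>Iso d\<^esub> x"
      have wc: "(1\<^sub>m d, w) \<in> carrier (Iso d)" using w(1) H by (meson subgroup.mem_carrier)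
      then have ye: "?y = (A, v + w)" using c by (simp add: xe mult_Iso)
      have "?y \<in> carrier (Iso d)" using wc x by simp
      then have "?y \<in> ?K" using w(2) by (simp add: ye)
      moreover have "H #>\<^bsub>Iso d\<^esub> ?y = H #>\<^bsub>Iso d\<^esub> x"
        using coset_mult_assoc[OF subgroup.subset[OF H] wc x] coset_join2[OF wc H w(1)] by simp
      ultimately show ?thesis by (intro image_eqI[OF sym])
    qed
    then show ?thesis
      unfolding quotient_imp_surjective_map[OF Q, symmetric] topspace_Iso_topology by blast
  qed
  ultimately show ?thesis
    using Q by (auto simp: cocompact_in_Iso_def compact_space_def)
qed

section \<open>Lifting free torus actions\<close>

lemma (in group) foldr_replicate_mult:
  assumes "x \<in> carrier G" "c \<in> carrier G"
  shows "foldr (\<otimes>) (replicate n x) c = x [^] n \<otimes> c"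
proof (induction n)
  case (Suc n)
  then show ?case using assms nat_pow_Suc2[of x n] m_assoc[of x "x [^] n" c] by simp
qed (use assms in simp)

lemma (in group) conjugate_pow:
  assumes "h \<in> carrier G" "x \<in> carrier G"
  shows "(h \<otimes> x \<otimes> inv h) [^] (n :: nat) = h \<otimes> x [^] n \<otimes> inv h"
proof (induction n)
  case (Suc n)
  have "(h \<otimes> x \<otimes> inv h) [^] Suc n = h \<otimes> x [^] n \<otimes> (inv h \<otimes> h) \<otimes> x \<otimes> inv h"
    using assms Suc by (simp only: nat_pow_Suc m_assoc m_closed inv_closed nat_pow_closed)
  then show ?case using assms by (simp add: m_assoc)
qed (use assms in simp)

lemma commutator_in_derived:
  fixes G (structure)
  assumes "a \<in> H" "b \<in> H"
  shows "a \<otimes> b \<otimes> inv a \<otimes> inv b \<in> derived G H"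
  unfolding derived_def
  by (rule generate.incl, rule UN_I[OF assms(1)], rule UN_I[OF assms(2)], rule singletonI)

lemma (in group) derived_eq_one_iff_commute:
  assumes "H \<subseteq> carrier G"
  shows "derived G H = {\<one>} \<longleftrightarrow> (\<forall>a\<in>H. \<forall>b\<in>H. a \<otimes> b = b \<otimes> a)"
proof -
  have *: "a \<otimes> b \<otimes> inv a \<otimes> inv b = \<one> \<longleftrightarrow> a \<otimes> b = b \<otimes> a" if "a \<in> H" "b \<in> H" for a b
  proof -
    have c: "a \<in> carrier G" "b \<in> carrier G" using that assms by auto
    have "a \<otimes> b \<otimes> inv a \<otimes> inv b = (a \<otimes> b) \<otimes> inv (b \<otimes> a)"
      using c by (simp add: m_assoc inv_mult_group)
    then show ?thesis using c by (metis inv_closed inv_equality inv_inv m_closed r_inv)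
  qed
  show ?thesis
  proof
    assume d: "derived G H = {\<one>}"
    then show "\<forall>a\<in>H. \<forall>b\<in>H. a \<otimes> b = b \<otimes> a"
      using * commutator_in_derived[of _ H _ G] by auto
  next
    assume "\<forall>a\<in>H. \<forall>b\<in>H. a \<otimes> b = b \<otimes> a"
    then have "derived_set G H \<subseteq> {\<one>}" using * by auto
    then have "derived G H \<subseteq> {\<one>}"
      unfolding derived_def by (rule generate_subgroup_incl[OF _ triv_subgroup])
    moreover have "\<one> \<in> derived G H" unfolding derived_def by (rule generate.one)
    ultimately show "derived G H = {\<one>}" by blast
  qed
qed

lemma (in group) exp_of_derived_normal: "(derived G ^^ n) (carrier G) \<lhd> G"
  by (induction n) (simp_all add: normal_self derived_is_normal)

lemma (in group) exp_of_derived_one: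
  assumes "(derived G ^^ k) H = {\<one>}" "k \<le> n"
  shows "(derived G ^^ n) H = {\<one>}"
proof -
  have "derived G {\<one>} = {\<one>}" by (subst derived_eq_one_iff_commute) auto
  then have "(derived G ^^ j) {\<one>} = {\<one>}" for j by (induction j) auto
  moreover have "(derived G ^^ n) H = (derived G ^^ (n - k)) ((derived G ^^ k) H)"
    using assms(2) by (metis comp_apply funpow_add le_add_diff_inverse2)
  ultimately show ?thesis using assms(1) by simp
qed

text \<open>Conjugate elements have the same image in a commutative group, so a product of
  \<open>k\<close> conjugates of \<open>x\<close> maps to the \<open>k\<close>-th power of
  \<open>h x\<close>. This later bounds generalized exponents from below.\<close>

lemma (in group_hom) pow_eq_one_if_generalized_period:
  assumes H: "comm_group H" and k: "is_generalized_period G k" and x: "x \<in> carrier G"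
  shows "h x [^]\<^bsub>H\<^esub> k = \<one>\<^bsub>H\<^esub>"
proof -
  interpret H: comm_group H by (rule H)
  let ?C = "(\<lambda>g. g \<otimes>\<^bsub>G\<^esub> x \<otimes>\<^bsub>G\<^esub> inv\<^bsub>G\<^esub> g) ` carrier G"
  obtain cs where cs: "\<one>\<^bsub>G\<^esub> = foldr (\<otimes>\<^bsub>G\<^esub>) cs \<one>\<^bsub>G\<^esub>" "length cs = k" "set cs \<subseteq> ?C"
    using k x unfolding is_generalized_period_def conjugacy_classes_def set_power_def by fastforce
  have C: "c \<in> carrier G \<and> h c = h x" if "c \<in> ?C" for c
    using that x by (auto simp: H.m_comm[of "h _" "h x"] H.m_assoc)
  have "foldr (\<otimes>\<^bsub>G\<^esub>) cs \<one>\<^bsub>G\<^esub> \<in> carrier G \<and> h (foldr (\<otimes>\<^bsub>G\<^esub>) cs \<one>\<^bsub>G\<^esub>) = h x [^]\<^bsub>H\<^esub> length cs"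
    using cs(3) by (induction cs) (use C x in \<open>auto simp: H.m_comm\<close>)
  then show ?thesis using cs by (metis hom_one)
qed

text \<open>An element \<open>g\<close> carries the \<open>i\<close>-th coordinate of \<open>(\<real>/N\<int>)\<^sup>d\<close> to the \<open>act g i\<close>-th one
  by \<open>u \<mapsto> sg g i * u + shift g i\<close>; values at \<open>i \<ge> d\<close> are irrelevant.\<close>

locale torus_action = P?: group P for P (structure) +
  fixes d :: nat and N :: int
    and act :: "'a \<Rightarrow> nat \<Rightarrow> nat" and sg :: "'a \<Rightarrow> nat \<Rightarrow> int" and shift :: "'a \<Rightarrow> nat \<Rightarrow> int"
  assumes fin: "finite (carrier P)" and N_pos: "0 < N"
    and act_lt: "\<And>g i. g \<in> carrier P \<Longrightarrow> i < d \<Longrightarrow> act g i < d"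
    and act_one: "\<And>i. i < d \<Longrightarrow> act \<one> i = i"
    and act_mult: "\<And>g h i. g \<in> carrier P \<Longrightarrow> h \<in> carrier P \<Longrightarrow> i < d \<Longrightarrow> act (g \<otimes> h) i = act g (act h i)"
    and sg_cases: "\<And>g i. g \<in> carrier P \<Longrightarrow> i < d \<Longrightarrow> sg g i = 1 \<or> sg g i = -1"
    and sg_mult: "\<And>g h i. g \<in> carrier P \<Longrightarrow> h \<in> carrier P \<Longrightarrow> i < d \<Longrightarrow> sg (g \<otimes> h) i = sg g (act h i) * sg h i"
    and shift_mult: "\<And>g h i. g \<in> carrier P \<Longrightarrow> h \<in> carrier P \<Longrightarrow> i < d \<Longrightarrow>
      N dvd shift (g \<otimes> h) i - (shift g (act h i) + sg g (act h i) * shift h i)"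
    and free: "\<And>g. g \<in> carrier P \<Longrightarrow> g \<noteq> \<one> \<Longrightarrow>
      \<exists>j::nat. \<exists>i<d. act (g [^] j) i = i \<and> sg (g [^] j) i = 1 \<and> \<not> N dvd shift (g [^] j) i"
    and flip: "\<And>i. i < d \<Longrightarrow> \<exists>s\<in>carrier P. act s i = i \<and> sg s i = -1"
begin

definition lin :: "'a \<Rightarrow> real mat" where
  "lin g = mat d d (\<lambda>(a, b). if a = act g b then of_int (sg g b) else 0)"

text \<open>These are the isometries of Euclidean space that induce the action of \<open>g\<close>
  on the torus. The shift recorded at the source coordinate \<open>i\<close> appears at its target
  \<open>act g i\<close>.\<close>

definition lifts :: "'a \<Rightarrow> isometry set" where
  "lifts g = {(lin g, v) |v. v \<in> carrier_vec d \<and> (\<forall>i<d. \<exists>z. v $ act g i = of_int (shift g i + N * z))}"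

definition lift_set :: "isometry set" where
  "lift_set = (\<Union>g\<in>carrier P. lifts g)"

definition lift_group :: "isometry monoid" where
  "lift_group = (Iso d)\<lparr>carrier := lift_set\<rparr>"

section \<open>Signed permutations and their matrices\<close>

lemma act_inv:
  assumes "g \<in> carrier P" "i < d"
  shows "act g (act (inv g) i) = i" "act (inv g) (act g i) = i"
  using assms act_mult[of g "inv g" i] act_mult[of "inv g" g i] by (simp_all add: act_one)

lemma act_inj: "g \<in> carrier P \<Longrightarrow> i < d \<Longrightarrow> j < d \<Longrightarrow> act g i = act g j \<longleftrightarrow> i = j"
  by (metis act_inv(2))

lemma obtain_act:
  assumes "g \<in> carrier P" "a < d"
  obtains i where "i < d" "a = act g i"
  using assms act_inv(1) act_lt by (metis inv_closed)

lemma lin_carrier [simp]: "lin g \<in> carrier_mat d d"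
  by (simp add: lin_def)

lemma dim_lin [simp]: "dim_row (lin g) = d" "dim_col (lin g) = d"
  by (simp_all add: lin_def)

lemma lin_mult_vec_carrier [simp]: "w \<in> carrier_vec d \<Longrightarrow> lin g *\<^sub>v w \<in> carrier_vec d"
  by (rule mult_mat_vec_carrier[OF lin_carrier])

lemma sg_one: "i < d \<Longrightarrow> sg \<one> i = 1"
  using sg_mult[of \<one> \<one> i] sg_cases[of \<one> i] by (auto simp: act_one)

lemma shift_one: "i < d \<Longrightarrow> N dvd shift \<one> i"
  using shift_mult[of \<one> \<one> i] by (simp add: act_one sg_one)

lemma lin_one: "lin \<one> = 1\<^sub>m d"
  by (rule eq_matI) (auto simp: lin_def act_one sg_one)

lemma lin_mult_vec:
  assumes "g \<in> carrier P" "w \<in> carrier_vec d" "i < d"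
  shows "(lin g *\<^sub>v w) $ act g i = of_int (sg g i) * w $ i"
proof -
  have "(lin g *\<^sub>v w) $ act g i = (\<Sum>b<d. lin g $$ (act g i, b) * w $ b)"
    using assms act_lt[of g i] by (simp add: lin_def scalar_prod_def atLeast0LessThan)
  also have "\<dots> = (\<Sum>b<d. if b = i then of_int (sg g i) * w $ i else 0)"
    using assms act_lt[of g i] by (intro sum.cong) (auto simp: lin_def act_inj)
  finally show ?thesis using assms by simp
qed

lemma lin_mult:
  assumes "g \<in> carrier P" "h \<in> carrier P"
  shows "lin (g \<otimes> h) = lin g * lin h"
proof (rule eq_matI)
  fix a b assume "a < dim_row (lin g * lin h)" "b < dim_col (lin g * lin h)"
  then have ab: "a < d" "b < d" by (simp_all add: lin_def)
  have "(lin g * lin h) $$ (a, b) = (\<Sum>c<d. lin g $$ (a, c) * lin h $$ (c, b))"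
    using ab by (simp add: lin_def scalar_prod_def atLeast0LessThan)
  also have "\<dots> = (\<Sum>c<d. if c = act h b then lin g $$ (a, act h b) * of_int (sg h b) else 0)"
    using ab by (intro sum.cong) (auto simp: lin_def)
  also have "\<dots> = lin (g \<otimes> h) $$ (a, b)"
    using ab assms act_lt by (simp add: lin_def act_mult sg_mult)
  finally show "lin (g \<otimes> h) $$ (a, b) = (lin g * lin h) $$ (a, b)" ..
qed (simp_all add: lin_def)

lemma lin_orthogonal:
  assumes "g \<in> carrier P"
  shows "transpose_mat (lin g) * lin g = 1\<^sub>m d"
proof (subst transpose_mult_self_eq_one_iff[OF lin_carrier], intro ballI)
  fix j k assume jk: "j \<in> {..<d}" "k \<in> {..<d}"
  have "(\<Sum>i<d. lin g $$ (i, j) * lin g $$ (i, k)) =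
    (\<Sum>i<d. if i = act g j then (if j = k then of_int (sg g j * sg g j) else 0) else 0)"
    using jk act_inj[OF assms] by (intro sum.cong) (auto simp: lin_def)
  also have "sg g j * sg g j = 1"
    using jk sg_cases[OF assms, of j] by auto
  also have "(\<Sum>i<d. if i = act g j then (if j = k then of_int 1 else 0) else 0) = (if j = k then 1 else 0 :: real)"
    using jk act_lt[OF assms, of j] by simp
  finally show "(\<Sum>i<d. lin g $$ (i, j) * lin g $$ (i, k)) = (if j = k then 1 else 0)" .
qed

section \<open>The group of all lifts\<close>

lemma lifts_subset:
  assumes "g \<in> carrier P"
  shows "lifts g \<subseteq> carrier (Iso d)"
  using lin_orthogonal[OF assms] by (auto simp: lifts_def carrier_Iso_iff)

lemma lift_set_subset: "lift_set \<subseteq> carrier (Iso d)"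
  using lifts_subset by (auto simp: lift_set_def)

lemma lifts_nonempty:
  assumes "g \<in> carrier P"
  shows "\<exists>x. x \<in> lifts g"
proof -
  let ?v = "vec d (\<lambda>a. of_int (shift g (act (inv g) a)))"
  have "\<forall>i<d. ?v $ act g i = of_int (shift g i + N * 0)"
    using assms by (simp add: act_lt act_inv)
  then have "(lin g, ?v) \<in> lifts g" unfolding lifts_def using vec_carrier by blast
  then show ?thesis by blast
qed

lemma lifts_one_iff:
  "x \<in> lifts \<one> \<longleftrightarrow> (\<exists>v\<in>carrier_vec d. x = (1\<^sub>m d, v) \<and> (\<forall>i<d. \<exists>z. v $ i = of_int (N * z)))"
proof -
  have "(\<exists>z. r = of_int (shift \<one> i + N * z)) \<longleftrightarrow> (\<exists>z. r = of_int (N * z))" if i: "i < d" for i and r :: real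
  proof -
    obtain c where "shift \<one> i = N * c" using shift_one[OF i] by blast
    then have "shift \<one> i + N * z = N * (z + c)" "N * z = shift \<one> i + N * (z - c)" for z
      by (simp_all add: algebra_simps)
    then show ?thesis by metis
  qed
  then show ?thesis by (auto simp: lifts_def lin_one act_one)
qed

lemma one_in_lifts: "\<one>\<^bsub>Iso d\<^esub> \<in> lifts \<one>"
  by (auto simp: lifts_one_iff one_Iso intro: exI[of _ 0])

text \<open>The laws \<open>sg_mult\<close> and \<open>shift_mult\<close> are those of composing the
  maps \<open>u \<mapsto> sg g i * u + shift g i\<close>; the error in \<open>shift_mult\<close> is
  a multiple of \<open>N\<close> and is absorbed into the free integer.\<close>

lemma lifts_mult:
  assumes g: "g \<in> carrier P" and h: "h \<in> carrier P" and x: "x \<in> lifts g" and y: "y \<in> lifts h"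
  shows "x \<otimes>\<^bsub>Iso d\<^esub> y \<in> lifts (g \<otimes> h)"
proof -
  obtain v w where x: "x = (lin g, v)" and v: "v \<in> carrier_vec d" "\<And>i. i < d \<Longrightarrow> \<exists>z. v $ act g i = of_int (shift g i + N * z)"
    and y: "y = (lin h, w)" and w: "w \<in> carrier_vec d" "\<And>i. i < d \<Longrightarrow> \<exists>z. w $ act h i = of_int (shift h i + N * z)"
    using x y by (auto simp: lifts_def)
  have "\<exists>z. (lin g *\<^sub>v w + v) $ act (g \<otimes> h) i = of_int (shift (g \<otimes> h) i + N * z)" if i: "i < d" for i
  proof -
    let ?j = "act h i"
    have j: "?j < d" "act g ?j < d" using act_lt g h i by auto
    obtain z1 z2 where z: "v $ act g ?j = of_int (shift g ?j + N * z1)" "w $ ?j = of_int (shift h i + N * z2)"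
      using v(2)[OF j(1)] w(2)[OF i] by blast
    obtain c where c: "shift (g \<otimes> h) i - (shift g ?j + sg g ?j * shift h i) = N * c"
      using shift_mult[OF g h i] by blast
    have "(lin g *\<^sub>v w + v) $ act (g \<otimes> h) i = of_int (sg g ?j * (shift h i + N * z2) + (shift g ?j + N * z1))"
      using j v(1) w(1) g by (simp add: act_mult[OF g h i] lin_mult_vec z del: index_mult_mat_vec)
    also have "sg g ?j * (shift h i + N * z2) + (shift g ?j + N * z1) =
       shift (g \<otimes> h) i + N * (sg g ?j * z2 + z1 - c)"
      using c by (simp add: algebra_simps)
    finally show ?thesis by blast
  qed
  then show ?thesis
    using v(1) w(1) lin_mult[OF g h] by (auto simp: x y mult_Iso lifts_def)
qed

text \<open>Instead of computing the inverse shift, take any lift \<open>y\<close> of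
  \<open>inv g\<close>. Then \<open>y\<close> times \<open>x\<close> is a lattice translation, and
  composing the opposite translation with \<open>y\<close> gives the inverse of
  \<open>x\<close>.\<close>

lemma lifts_inv:
  assumes g: "g \<in> carrier P" and x: "x \<in> lifts g"
  shows "inv\<^bsub>Iso d\<^esub> x \<in> lifts (inv g)"
proof -
  interpret I: group "Iso d" by (rule group_Iso)
  obtain y where y: "y \<in> lifts (inv g)" using lifts_nonempty g by blast
  have c: "x \<in> carrier (Iso d)" "y \<in> carrier (Iso d)"
    using lifts_subset g x y by auto
  have "y \<otimes>\<^bsub>Iso d\<^esub> x \<in> lifts \<one>" using lifts_mult[OF _ g y x] g by simp
  then obtain v where v: "v \<in> carrier_vec d" "y \<otimes>\<^bsub>Iso d\<^esub> x = (1\<^sub>m d, v)" "\<forall>i<d. \<exists>z. v $ i = of_int (N * z)"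
    unfolding lifts_one_iff by blast
  let ?t = "(1\<^sub>m d, - v) :: isometry"
  have nv: "- v \<in> carrier_vec d" using v(1) by (rule uminus_carrier_vec[THEN iffD2])
  have t: "?t \<in> lifts \<one>"
    unfolding lifts_one_iff
  proof (intro bexI[OF _ nv] conjI refl allI impI)
    fix i assume i: "i < d"
    then obtain z where "v $ i = of_int (N * z)" using v(3) by blast
    then have "(- v) $ i = of_int (N * - z)" using i v(1) by simp
    then show "\<exists>z. (- v) $ i = of_int (N * z)" by blast
  qed
  have tc: "?t \<in> carrier (Iso d)" using t lifts_subset by blast
  have "?t \<otimes>\<^bsub>Iso d\<^esub> y \<otimes>\<^bsub>Iso d\<^esub> x = ?t \<otimes>\<^bsub>Iso d\<^esub> (1\<^sub>m d, v)"
    using c tc v(2) by (simp add: I.m_assoc)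
  also have "\<dots> = \<one>\<^bsub>Iso d\<^esub>" using v(1) by (simp add: mult_Iso one_Iso uminus_r_inv_vec)
  finally have "inv\<^bsub>Iso d\<^esub> x = ?t \<otimes>\<^bsub>Iso d\<^esub> y" using c tc by (intro I.inv_equality) auto
  then show ?thesis using lifts_mult[OF one_closed _ t y] g by simp
qed

lemma lift_set_subgroup: "subgroup lift_set (Iso d)"
proof (rule group.subgroupI[OF group_Iso lift_set_subset])
  show "lift_set \<noteq> {}" using one_in_lifts by (auto simp: lift_set_def)
  show "inv\<^bsub>Iso d\<^esub> x \<in> lift_set" if "x \<in> lift_set" for x
    using that lifts_inv unfolding lift_set_def by blast
  show "x \<otimes>\<^bsub>Iso d\<^esub> y \<in> lift_set" if "x \<in> lift_set" "y \<in> lift_set" for x y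
    using that lifts_mult unfolding lift_set_def by (metis (no_types, lifting) UN_iff m_closed)
qed

lemma group_lift_group: "group lift_group"
  unfolding lift_group_def using lift_set_subgroup group_Iso by (rule subgroup.subgroup_is_group)

lemma carrier_lift_group: "carrier lift_group = lift_set"
  and mult_lift_group: "x \<otimes>\<^bsub>lift_group\<^esub> y = x \<otimes>\<^bsub>Iso d\<^esub> y"
  and one_lift_group: "\<one>\<^bsub>lift_group\<^esub> = \<one>\<^bsub>Iso d\<^esub>"
  by (simp_all add: lift_group_def)

lemma in_lift_setI: "g \<in> carrier P \<Longrightarrow> x \<in> lifts g \<Longrightarrow> x \<in> carrier lift_group"
  by (auto simp: carrier_lift_group lift_set_def)

lemma discrete_lift_set: "discrete_in_Iso d lift_set"
proof (rule discrete_in_Iso_if_integral[OF lift_set_subset])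
  fix A v i j assume "(A, v) \<in> lift_set" and ij: "i < d" "j < d"
  then obtain g where g: "g \<in> carrier P" "A = lin g" "\<forall>i<d. \<exists>z. v $ act g i = of_int (shift g i + N * z)"
    by (auto simp: lift_set_def lifts_def)
  obtain k where "k < d" "i = act g k" using obtain_act[OF g(1) ij(1)] .
  then have "\<exists>z. v $ i = of_int z" using g(3) by blast
  then show "A $$ (i, j) \<in> \<int> \<and> v $ i \<in> \<int>"
    using ij by (auto simp: g(2) lin_def)
qed

lemma cocompact_lift_set: "cocompact_in_Iso d lift_set"
proof (rule cocompact_in_Iso_if_translations[OF lift_set_subgroup, where b = "of_int N"])
  fix v :: "real vec" assume v: "v \<in> carrier_vec d"
  \<comment> \<open>Subtracting from each coordinate the multiple of \<open>N\<close> just below it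
    moves \<open>v\<close> into the cube of side \<open>N\<close>.\<close>
  let ?w = "vec d (\<lambda>i. of_int (N * - \<lfloor>v $ i / of_int N\<rfloor>)) :: real vec"
  have "?w $ i = of_int (N * - \<lfloor>v $ i / of_int N\<rfloor>)" if "i < d" for i
    using that by simp
  then have "(1\<^sub>m d, ?w) \<in> lifts \<one>"
    unfolding lifts_one_iff using vec_carrier by blast
  then have "(1\<^sub>m d, ?w) \<in> lift_set"
    unfolding lift_set_def using one_closed by blast
  moreover have "(v + ?w) $ i \<in> {0..of_int N}" if "i < d" for i
  proof -
    let ?f = "\<lfloor>v $ i / of_int N\<rfloor>"
    have "of_int ?f * of_int N \<le> v $ i" "v $ i < (of_int ?f + 1) * of_int N"
      using N_pos floor_correct[of "v $ i / of_int N"]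
      by (simp_all only: le_divide_eq divide_less_eq of_int_0_less_iff if_True of_int_add of_int_1)
    then show ?thesis using that v by (simp add: algebra_simps)
  qed
  ultimately show "\<exists>w. (1\<^sub>m d, w) \<in> lift_set \<and> (\<forall>i<d. (v + w) $ i \<in> {0..of_int N})" by blast
qed

section \<open>Torsion-freeness\<close>

lemma lifts_pow:
  assumes "g \<in> carrier P" "x \<in> lifts g"
  shows "x [^]\<^bsub>Iso d\<^esub> (n::nat) \<in> lifts (g [^] n)"
  using assms one_in_lifts by (induction n) (auto intro: lifts_mult)

text \<open>By \<open>free\<close> some power of \<open>g\<close> maps an axis \<open>i\<close> to
  itself with sign 1 and a shift not divisible by \<open>N\<close>. The corresponding power of
  \<open>x\<close> then moves coordinate \<open>i\<close> by a fixed nonzero amount, and under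
  iteration these displacements add up and never return to 0.\<close>

lemma not_lifts_of_finite_order:
  assumes g: "g \<in> carrier P" "g \<noteq> \<one>" and x: "x \<in> lifts g" and n: "(n::nat) > 0"
  shows "x [^]\<^bsub>Iso d\<^esub> n \<noteq> \<one>\<^bsub>Iso d\<^esub>"
proof
  interpret I: group "Iso d" by (rule group_Iso)
  assume xn: "x [^]\<^bsub>Iso d\<^esub> n = \<one>\<^bsub>Iso d\<^esub>"
  obtain j i where i: "i < d" "act (g [^] (j::nat)) i = i" "sg (g [^] j) i = 1" "\<not> N dvd shift (g [^] j) i"
    using free[OF g] by blast
  have xc: "x \<in> carrier (Iso d)" using lifts_subset g x by blast
  define h where "h = g [^] j"
  have h: "h \<in> carrier P" using g by (simp add: h_def)
  have "x [^]\<^bsub>Iso d\<^esub> j \<in> lifts h" using lifts_pow g x by (simp add: h_def)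
  then obtain v where v: "x [^]\<^bsub>Iso d\<^esub> j = (lin h, v)" "v \<in> carrier_vec d"
      "\<forall>i<d. \<exists>z. v $ act h i = of_int (shift h i + N * z)"
    by (auto simp: lifts_def)
  then obtain z where "v $ i = of_int (shift h i + N * z)" using i by (metis h_def)
  moreover have "shift h i + N * z \<noteq> 0"
    using i(4) by (metis add_eq_0_iff dvd_triv_left dvd_minus_iff h_def)
  ultimately have vi: "v $ i \<noteq> 0" by (metis of_int_eq_0_iff)
  have cp: "(lin h, v) \<in> carrier (Iso d)" using v(1) xc I.nat_pow_closed by metis
  have "\<exists>B u. (lin h, v) [^]\<^bsub>Iso d\<^esub> m = (B, u) \<and> u \<in> carrier_vec d \<and> u $ i = of_nat m * v $ i" for m :: nat
  proof (induction m)
    case 0 show ?case using i by (simp add: one_Iso)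
  next
    case (Suc m)
    then obtain B u where u: "(lin h, v) [^]\<^bsub>Iso d\<^esub> m = (B, u)" "u \<in> carrier_vec d" "u $ i = of_nat m * v $ i" by blast
    have "(lin h *\<^sub>v u) $ i = u $ i" using lin_mult_vec[OF h u(2) i(1)] i by (simp add: h_def)
    then show ?case
      unfolding I.nat_pow_Suc2[OF cp] u(1) mult_Iso using u(2,3) v(2) i(1)
      by (auto simp: algebra_simps intro!: add_carrier_vec)
  qed
  then obtain B u where "(lin h, v) [^]\<^bsub>Iso d\<^esub> n = (B, u)" "u $ i = of_nat n * v $ i" by blast
  moreover have "(x [^]\<^bsub>Iso d\<^esub> j) [^]\<^bsub>Iso d\<^esub> n = \<one>\<^bsub>Iso d\<^esub>"
    using xc xn by (metis I.nat_pow_one I.nat_pow_pow mult.commute)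
  ultimately have "of_nat n * v $ i = 0" using v(1) i(1) by (simp add: one_Iso)
  then show False using vi n by simp
qed

text \<open>A common lift would make the identity a lift of \<open>inv g \<otimes> h\<close>,
  contrary to \<open>not_lifts_of_finite_order\<close> with exponent 1.\<close>

lemma lifts_disjoint:
  assumes g: "g \<in> carrier P" and h: "h \<in> carrier P" and x: "x \<in> lifts g" "x \<in> lifts h"
  shows "g = h"
proof (rule ccontr)
  interpret I: group "Iso d" by (rule group_Iso)
  assume "g \<noteq> h"
  then have ne: "inv g \<otimes> h \<noteq> \<one>" using g h by (metis inv_closed inv_equality inv_inv)
  have "inv\<^bsub>Iso d\<^esub> x \<otimes>\<^bsub>Iso d\<^esub> x \<in> lifts (inv g \<otimes> h)"
    using lifts_mult[OF _ h lifts_inv[OF g x(1)] x(2)] g by simp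
  moreover have "inv\<^bsub>Iso d\<^esub> x \<otimes>\<^bsub>Iso d\<^esub> x = \<one>\<^bsub>Iso d\<^esub>"
    using lifts_subset g x(1) by (intro I.l_inv) blast
  ultimately show False
    using not_lifts_of_finite_order[OF _ ne, of "\<one>\<^bsub>Iso d\<^esub>" 1] g h by simp
qed

lemma lift_group_pow: "x [^]\<^bsub>lift_group\<^esub> (n::nat) = x [^]\<^bsub>Iso d\<^esub> n"
  unfolding lift_group_def by (simp add: nat_pow_def)

text \<open>An element of finite order lies over \<open>\<one>\<close> by
  \<open>not_lifts_of_finite_order\<close>, so it is a translation by some \<open>v\<close>; its
  \<open>n\<close>-th power translates by \<open>n\<close> times \<open>v\<close>.\<close>

lemma torsion_free_lift_group: "torsion_free lift_group"
  unfolding torsion_free_def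
proof (intro ballI allI impI)
  fix x and n :: nat assume x: "x \<in> carrier lift_group" and n: "0 < n" and xn: "x [^]\<^bsub>lift_group\<^esub> n = \<one>\<^bsub>lift_group\<^esub>"
  obtain g where g: "g \<in> carrier P" "x \<in> lifts g" using x by (auto simp: carrier_lift_group lift_set_def)
  have xn: "x [^]\<^bsub>Iso d\<^esub> n = \<one>\<^bsub>Iso d\<^esub>" using xn by (simp add: lift_group_pow one_lift_group)
  then have "g = \<one>" using not_lifts_of_finite_order g n by blast
  then obtain v where v: "v \<in> carrier_vec d" "x = (1\<^sub>m d, v)" using g(2) by (auto simp: lifts_one_iff)
  have "(1\<^sub>m d, v) [^]\<^bsub>Iso d\<^esub> m = (1\<^sub>m d, of_nat m \<cdot>\<^sub>v v)" for m :: nat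
  proof (induction m)
    case (Suc m)
    then have "(1\<^sub>m d, v) [^]\<^bsub>Iso d\<^esub> Suc m = (1\<^sub>m d, v + of_nat m \<cdot>\<^sub>v v)"
      using v(1) by (simp add: mult_Iso)
    also have "v + of_nat m \<cdot>\<^sub>v v = of_nat (Suc m) \<cdot>\<^sub>v v"
      using v(1) by (intro eq_vecI) (auto simp: algebra_simps)
    finally show ?case .
  qed (use v in \<open>auto simp: one_Iso\<close>)
  then have *: "of_nat n \<cdot>\<^sub>v v = 0\<^sub>v d" using xn v(2) by (simp add: one_Iso)
  have "v $ i = 0" if "i < d" for i
  proof -
    have "(of_nat n \<cdot>\<^sub>v v) $ i = 0" using * that by simp
    then show ?thesis using that v(1) n by simp
  qed
  then have "v = 0\<^sub>v d" using v(1) by (intro eq_vecI) auto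
  then show "x = \<one>\<^bsub>lift_group\<^esub>" by (simp add: v(2) one_lift_group one_Iso)
qed

theorem Bieberbach_lift_group: "Bieberbach_group lift_group"
  unfolding Bieberbach_group_def crystallographic_group_def
  using torsion_free_lift_group discrete_lift_set cocompact_lift_set lift_set_subgroup lift_group_def by blast

text \<open>Some \<open>s\<close> maps the axis \<open>b\<close> to itself with sign -1. Replacing
  \<open>q\<close> by \<open>q \<otimes> s\<close> permutes the summands and negates column
  \<open>b\<close>, so the sum equals its own negative.\<close>

lemma sum_lin_eq_zero:
  assumes ab: "a < d" "b < d"
  shows "(\<Sum>q\<in>carrier P. lin q $$ (a, b)) = 0"
proof -
  obtain s where s: "s \<in> carrier P" "act s b = b" "sg s b = -1" using flip ab by blast
  have "(\<Sum>q\<in>carrier P. lin q $$ (a, b)) = (\<Sum>q\<in>carrier P. lin (q \<otimes> s) $$ (a, b))"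
    by (rule sum.reindex_bij_witness[of _ "\<lambda>q. q \<otimes> s" "\<lambda>q. q \<otimes> inv s"]) (use s in \<open>auto simp: m_assoc\<close>)
  also have "\<dots> = (\<Sum>q\<in>carrier P. - (lin q $$ (a, b)))"
    using s ab by (intro sum.cong) (auto simp: lin_def act_mult sg_mult)
  finally show ?thesis by (simp add: sum_negf)
qed

lemma conjugate_translation:
  assumes g: "g \<in> carrier P" and h: "h \<in> lifts g" and w: "(1\<^sub>m d, w) \<in> carrier (Iso d)"
  shows "h \<otimes>\<^bsub>Iso d\<^esub> (1\<^sub>m d, w) \<otimes>\<^bsub>Iso d\<^esub> inv\<^bsub>Iso d\<^esub> h = (1\<^sub>m d, lin g *\<^sub>v w)"
proof -
  interpret I: group "Iso d" by (rule group_Iso)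
  have hc: "h \<in> carrier (Iso d)" using lifts_subset g h by blast
  have wc: "w \<in> carrier_vec d" using w by (simp add: carrier_Iso_iff)
  obtain v where v: "h = (lin g, v)" "v \<in> carrier_vec d" using h by (auto simp: lifts_def)
  have t: "(1\<^sub>m d, lin g *\<^sub>v w) \<in> carrier (Iso d)" using wc by (simp add: carrier_Iso_iff)
  have "h \<otimes>\<^bsub>Iso d\<^esub> (1\<^sub>m d, w) = (1\<^sub>m d, lin g *\<^sub>v w) \<otimes>\<^bsub>Iso d\<^esub> h"
    using v wc comm_add_vec[of "lin g *\<^sub>v w" d v]
    by (simp add: mult_Iso left_mult_one_mat[OF lin_carrier] right_mult_one_mat[OF lin_carrier])
  then show ?thesis using hc w t by (simp add: I.m_assoc)
qed

lemma foldr_translations: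
  assumes qs: "distinct qs" "set qs \<subseteq> carrier P" and w: "w \<in> carrier_vec d"
  shows "foldr (\<otimes>\<^bsub>Iso d\<^esub>) (map (\<lambda>q. (1\<^sub>m d, lin q *\<^sub>v w)) qs) \<one>\<^bsub>Iso d\<^esub> =
    (1\<^sub>m d, vec d (\<lambda>a. \<Sum>q\<in>set qs. (lin q *\<^sub>v w) $ a))"
  using qs
proof (induction qs)
  case (Cons q qs)
  have "lin q *\<^sub>v w \<in> carrier_vec d" using w by simp
  then show ?case using Cons
    by (auto simp: mult_Iso add.commute simp del: index_mult_mat_vec intro!: eq_vecI)
qed (auto simp: one_Iso)

lemma period_lift_group: "is_generalized_period lift_group (Coset.order P * Coset.order P)"
proof -
  interpret I: group "Iso d" by (rule group_Iso)
  let ?n = "Coset.order P"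
  have n0: "?n > 0" using fin order_gt_0_iff_finite by blast
  have "\<one>\<^bsub>lift_group\<^esub> \<in> set_power lift_group C (?n * ?n)" if C0: "C \<in> conjugacy_classes lift_group" for C
  proof -
    obtain x where x: "x \<in> carrier lift_group"
      and C: "C = (\<lambda>g. g \<otimes>\<^bsub>lift_group\<^esub> x \<otimes>\<^bsub>lift_group\<^esub> inv\<^bsub>lift_group\<^esub> g) ` carrier lift_group"
      using C0 unfolding conjugacy_classes_def by blast
    obtain g where g: "g \<in> carrier P" "x \<in> lifts g" using x by (auto simp: carrier_lift_group lift_set_def)
    have xc: "x \<in> carrier (Iso d)" using g lifts_subset by blast
    have "x [^]\<^bsub>Iso d\<^esub> ?n \<in> lifts \<one>"
      using lifts_pow[OF g, of ?n] pow_order_eq_1[OF g(1)] by simp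
    then obtain w where w: "w \<in> carrier_vec d" "x [^]\<^bsub>Iso d\<^esub> ?n = (1\<^sub>m d, w)"
      by (auto simp: lifts_one_iff)
    obtain h where h: "\<And>q. q \<in> carrier P \<Longrightarrow> h q \<in> lifts q" using lifts_nonempty by metis
    have hc: "h q \<in> carrier (Iso d)" if "q \<in> carrier P" for q using h lifts_subset that by blast
    obtain qs where qs: "set qs = carrier P" "distinct qs" "length qs = ?n"
      using finite_distinct_list[OF fin] distinct_card unfolding Coset.order_def by metis
    define c where "c q = h q \<otimes>\<^bsub>Iso d\<^esub> x \<otimes>\<^bsub>Iso d\<^esub> inv\<^bsub>Iso d\<^esub> h q" for q
    have cc: "c q \<in> carrier (Iso d)" if "q \<in> carrier P" for q
      using hc[OF that] xc by (simp add: c_def)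
    have cC: "c q \<in> C" if "q \<in> carrier P" for q
    proof -
      have "h q \<in> carrier lift_group" using in_lift_setI h that by blast
      moreover have "inv\<^bsub>lift_group\<^esub> h q = inv\<^bsub>Iso d\<^esub> h q"
        unfolding lift_group_def using I.m_inv_consistent[OF lift_set_subgroup] calculation
        by (simp add: carrier_lift_group)
      ultimately show ?thesis unfolding C c_def by (auto simp: mult_lift_group intro!: image_eqI[of _ _ "h q"])
    qed
    have cpow: "c q [^]\<^bsub>Iso d\<^esub> ?n = (1\<^sub>m d, lin q *\<^sub>v w)" if "q \<in> carrier P" for q
      unfolding c_def I.conjugate_pow[OF hc[OF that] xc] w(2)
      using conjugate_translation[OF that h[OF that]] w xc by (metis I.nat_pow_closed)
    \<comment> \<open>Each conjugate is repeated \<open>?n\<close> times, so its block collapses to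
      the \<open>?n\<close>-th power of \<open>c q\<close>, a translation by
      \<open>lin q *\<^sub>v w\<close>. There are \<open>?n\<close> blocks of length
      \<open>?n\<close>.\<close>
    let ?cs = "concat (map (\<lambda>q. replicate ?n (c q)) qs)"
    have "foldr (\<otimes>\<^bsub>Iso d\<^esub>) (concat (map (\<lambda>q. replicate ?n (c q)) ps)) \<one>\<^bsub>Iso d\<^esub> =
        foldr (\<otimes>\<^bsub>Iso d\<^esub>) (map (\<lambda>q. (1\<^sub>m d, lin q *\<^sub>v w)) ps) \<one>\<^bsub>Iso d\<^esub> \<and>
        foldr (\<otimes>\<^bsub>Iso d\<^esub>) (map (\<lambda>q. (1\<^sub>m d, lin q *\<^sub>v w)) ps) \<one>\<^bsub>Iso d\<^esub> \<in> carrier (Iso d)"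
      if "set ps \<subseteq> carrier P" for ps
      using that
    proof (induction ps)
      case (Cons q ps)
      then show ?case
        using I.foldr_replicate_mult[OF cc] cpow cc I.nat_pow_closed[OF cc, of q ?n] by simp
    qed simp
    then have "foldr (\<otimes>\<^bsub>Iso d\<^esub>) ?cs \<one>\<^bsub>Iso d\<^esub> = foldr (\<otimes>\<^bsub>Iso d\<^esub>) (map (\<lambda>q. (1\<^sub>m d, lin q *\<^sub>v w)) qs) \<one>\<^bsub>Iso d\<^esub>"
      using qs by simp
    also have "\<dots> = (1\<^sub>m d, vec d (\<lambda>a. \<Sum>q\<in>carrier P. (lin q *\<^sub>v w) $ a))"
      using foldr_translations[of qs w] qs w by simp
    also have "vec d (\<lambda>a. \<Sum>q\<in>carrier P. (lin q *\<^sub>v w) $ a) = 0\<^sub>v d"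
    proof (rule eq_vecI)
      fix a assume "a < dim_vec (0\<^sub>v d :: real vec)"
      then have a: "a < d" by simp
      have "(\<Sum>q\<in>carrier P. (lin q *\<^sub>v w) $ a) = (\<Sum>q\<in>carrier P. \<Sum>b<d. lin q $$ (a, b) * w $ b)"
        using a w(1) by (intro sum.cong) (auto simp: scalar_prod_def atLeast0LessThan lin_def)
      also have "\<dots> = (\<Sum>b<d. (\<Sum>q\<in>carrier P. lin q $$ (a, b)) * w $ b)"
        by (subst sum.swap) (simp add: sum_distrib_right)
      also have "\<dots> = 0" using a by (intro sum.neutral) (auto simp: sum_lin_eq_zero)
      finally show "vec d (\<lambda>a. \<Sum>q\<in>carrier P. (lin q *\<^sub>v w) $ a) $ a = 0\<^sub>v d $ a" using a by simp
    qed simp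
    finally have "\<one>\<^bsub>lift_group\<^esub> = foldr (\<otimes>\<^bsub>lift_group\<^esub>) ?cs \<one>\<^bsub>lift_group\<^esub>"
      by (simp add: lift_group_def one_Iso)
    moreover have "length ?cs = ?n * ?n"
      using qs(3) by (simp add: length_concat comp_def sum_list_triv)
    moreover have "set ?cs \<subseteq> C" using cC qs(1) by auto
    ultimately show ?thesis unfolding set_power_def by blast
  qed
  then show ?thesis using n0 by (simp add: is_generalized_period_def)
qed

corollary finite_generalized_exponent_lift_group: "finite_generalized_exponent lift_group"
  using period_lift_group by (auto simp: finite_generalized_exponent_def)

section \<open>The projection onto \<open>P\<close> and the derived series\<close>

definition holonomy :: "isometry \<Rightarrow> 'a" where
  "holonomy x = (THE g. g \<in> carrier P \<and> x \<in> lifts g)"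

lemma holonomy_eq: "g \<in> carrier P \<Longrightarrow> x \<in> lifts g \<Longrightarrow> holonomy x = g"
  unfolding holonomy_def using lifts_disjoint by blast

lemma holonomy_lifts:
  assumes "x \<in> carrier lift_group"
  shows "holonomy x \<in> carrier P" "x \<in> lifts (holonomy x)"
proof -
  obtain g where "g \<in> carrier P" "x \<in> lifts g" using assms by (auto simp: carrier_lift_group lift_set_def)
  then show "holonomy x \<in> carrier P" "x \<in> lifts (holonomy x)" using holonomy_eq by auto
qed

lemma holonomy_hom: "group_hom lift_group P holonomy"
proof -
  have "holonomy (x \<otimes>\<^bsub>lift_group\<^esub> y) = holonomy x \<otimes> holonomy y"
    if "x \<in> carrier lift_group" "y \<in> carrier lift_group" for x y
    using holonomy_lifts[OF that(1)] holonomy_lifts[OF that(2)]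
    by (intro holonomy_eq) (auto simp: mult_lift_group intro: lifts_mult)
  then show ?thesis
    using group_lift_group P.is_group holonomy_lifts(1)
    by (auto simp: group_hom_def group_hom_axioms_def hom_def)
qed

lemma holonomy_surj: "holonomy ` carrier lift_group = carrier P"
proof (intro equalityI subsetI)
  fix g assume g: "g \<in> carrier P"
  then obtain x where "x \<in> lifts g" using lifts_nonempty by blast
  then show "g \<in> holonomy ` carrier lift_group" using g holonomy_eq in_lift_setI by (metis imageI)
qed (use holonomy_lifts(1) in auto)

text \<open>If the last nontrivial derived subgroup of \<open>P\<close> contains an element reversing a coordinate axis,
  then the commutator of a lift of it with a translation along that axis is a translation
  by which the corresponding derived subgroup of \<open>lift_group\<close> fails to be abelian.\<close>

theorem derived_length_lift_group:
  assumes m: "(derived P ^^ Suc m) (carrier P) = {\<one>}"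
    and g: "g \<in> (derived P ^^ m) (carrier P)" and i: "i < d" "act g i = i" "sg g i = -1"
  shows "solvable lift_group" "derived_length lift_group = m + 2"
proof -
  interpret I: group "Iso d" by (rule group_Iso)
  interpret G: group lift_group by (rule group_lift_group)
  interpret hol: group_hom lift_group P holonomy by (rule holonomy_hom)
  define D where "D k = (derived lift_group ^^ k) (carrier lift_group)" for k
  have D_sub: "D k \<subseteq> carrier lift_group" for k
    unfolding D_def by (rule G.exp_of_derived_in_carrier) simp
  have D_Suc: "D (Suc k) = derived lift_group (D k)" for k
    by (simp add: D_def)
  have img: "holonomy ` D k = (derived P ^^ k) (carrier P)" for k
    unfolding D_def using hol.exp_of_derived_img[of "carrier lift_group" k] holonomy_surj by simp
  \<comment> \<open>The derived subgroup with index \<open>Suc m\<close> lies over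
    \<open>\<one>\<close>, hence consists of commuting translations; one more step makes it
    trivial.\<close>
  have "D (Suc m) \<subseteq> lifts \<one>"
  proof
    fix x assume x: "x \<in> D (Suc m)"
    then have "holonomy x = \<one>" using img[of "Suc m"] m by blast
    then show "x \<in> lifts \<one>" using holonomy_lifts(2)[of x] D_sub[of "Suc m"] x by auto
  qed
  then have "\<forall>x\<in>D (Suc m). \<forall>y\<in>D (Suc m). x \<otimes>\<^bsub>lift_group\<^esub> y = y \<otimes>\<^bsub>lift_group\<^esub> x"
    unfolding mult_lift_group
  proof (intro ballI)
    fix x y assume "D (Suc m) \<subseteq> lifts \<one>" "x \<in> D (Suc m)" "y \<in> D (Suc m)"
    then obtain v w where "x = (1\<^sub>m d, v)" "v \<in> carrier_vec d" "y = (1\<^sub>m d, w)" "w \<in> carrier_vec d"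
      using lifts_one_iff by (metis subsetD)
    then show "x \<otimes>\<^bsub>Iso d\<^esub> y = y \<otimes>\<^bsub>Iso d\<^esub> x"
      using comm_add_vec[of v d w] by (simp add: mult_Iso)
  qed
  then have top: "D (Suc (Suc m)) = {\<one>\<^bsub>lift_group\<^esub>}"
    unfolding D_Suc[of "Suc m"] G.derived_eq_one_iff_commute[OF D_sub] .
  \<comment> \<open>Triviality here would make \<open>D m\<close> abelian; a lift \<open>a\<close>
    of \<open>g\<close> in \<open>D m\<close> and its conjugate \<open>c\<close> by a translation
    refute that.\<close>
  have ne: "D (Suc m) \<noteq> {\<one>\<^bsub>lift_group\<^esub>}"
  proof
    assume "D (Suc m) = {\<one>\<^bsub>lift_group\<^esub>}"
    then have comm: "\<forall>x\<in>D m. \<forall>y\<in>D m. x \<otimes>\<^bsub>lift_group\<^esub> y = y \<otimes>\<^bsub>lift_group\<^esub> x"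
      unfolding D_Suc G.derived_eq_one_iff_commute[OF D_sub] .
    have gP: "g \<in> carrier P" using g P.exp_of_derived_in_carrier[of "carrier P" m] by auto
    obtain a where a: "a \<in> D m" "holonomy a = g" using g unfolding img[symmetric] by blast
    then have "a \<in> lifts g" using holonomy_lifts(2)[of a] D_sub[of m] by auto
    then obtain v where v: "a = (lin g, v)" "v \<in> carrier_vec d" by (auto simp: lifts_def)
    \<comment> \<open>The factor \<open>N\<close> makes the translation along axis \<open>i\<close>
      a lattice translation, hence an element of \<open>lift_group\<close>.\<close>
    define e where "e = (of_int N :: real) \<cdot>\<^sub>v unit_vec d i"
    have e: "e \<in> carrier_vec d" by (simp add: e_def)
    define t :: isometry where "t = (1\<^sub>m d, e)"
    have "e $ j = of_int (N * (if j = i then 1 else 0))" if "j < d" for j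
      using that i(1) by (simp add: e_def)
    then have tl: "t \<in> lifts \<one>" using e by (auto simp: lifts_one_iff t_def)
    then have tG: "t \<in> carrier lift_group" using in_lift_setI one_closed by blast
    have aG: "a \<in> carrier lift_group" using a D_sub by blast
    define c where "c = t \<otimes>\<^bsub>lift_group\<^esub> a \<otimes>\<^bsub>lift_group\<^esub> inv\<^bsub>lift_group\<^esub> t"
    have cD: "c \<in> D m"
      unfolding c_def using G.exp_of_derived_normal[of m] a(1) tG
      by (auto simp: G.normal_inv_iff D_def)
    have le: "lin g *\<^sub>v e = - e"
    proof (rule eq_vecI)
      fix k assume "k < dim_vec (- e)"
      then have "k < d" using e by simp
      then obtain j where j: "j < d" "k = act g j" using obtain_act gP by metis
      then show "(lin g *\<^sub>v e) $ k = (- e) $ k"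
        unfolding j(2) lin_mult_vec[OF gP e j(1)]
        using act_inj[OF gP j(1) i(1)] i j \<open>k < d\<close> by (cases "j = i") (simp_all add: e_def)
    qed (use e in simp)
    \<comment> \<open>Conjugation by \<open>t\<close> adds \<open>e\<close> minus
      \<open>lin g *\<^sub>v e\<close> to the vector part, which is twice \<open>e\<close>.\<close>
    have c: "c = (lin g, v + e + e)"
    proof -
      have w: "(lin g, v + e + e) \<in> carrier (Iso d)"
        using e v(2) lin_orthogonal[OF gP] by (simp add: carrier_Iso_iff)
      have "(lin g, v + e + e) \<otimes>\<^bsub>Iso d\<^esub> t = t \<otimes>\<^bsub>Iso d\<^esub> a"
        using e v by (auto simp: t_def mult_Iso le intro!: eq_vecI)
      then have "c = (lin g, v + e + e) \<otimes>\<^bsub>Iso d\<^esub> t \<otimes>\<^bsub>Iso d\<^esub> inv\<^bsub>Iso d\<^esub> t"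
        unfolding c_def lift_group_def using I.m_inv_consistent[OF lift_set_subgroup] tG
        by (simp add: carrier_lift_group)
      then show ?thesis using w tG lift_set_subset by (auto simp: I.m_assoc carrier_lift_group)
    qed
    \<comment> \<open>Commutation of \<open>a\<close> with \<open>c\<close> equates
      \<open>- e - e\<close> with \<open>e + e\<close> in coordinate \<open>i\<close>; this forces
      \<open>e $ i\<close> to vanish, although it is \<open>N\<close>.\<close>
    have "snd (a \<otimes>\<^bsub>Iso d\<^esub> c) $ i = snd (c \<otimes>\<^bsub>Iso d\<^esub> a) $ i"
      using comm a(1) cD by (simp add: mult_lift_group)
    moreover have "lin g *\<^sub>v (v + e + e) = lin g *\<^sub>v v + - e + - e"
      using e v(2) by (simp add: mult_add_distrib_mat_vec[OF lin_carrier] le assoc_add_vec[of _ d])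
    ultimately have "(lin g *\<^sub>v v + - e + - e + v) $ i = (lin g *\<^sub>v v + (v + e + e)) $ i"
      unfolding c v(1) mult_Iso by simp
    moreover have "(lin g *\<^sub>v v) $ i = (lin g *\<^sub>v v) $ i" "lin g *\<^sub>v v \<in> carrier_vec d" using v(2) by simp_all
    ultimately have "e $ i = 0" using e v(2) i(1) by simp
    then show False using i(1) N_pos by (simp add: e_def)
  qed
  show "solvable lift_group"
    unfolding G.solvable_iff_trivial_derived_seq using top unfolding D_def by blast
  show "derived_length lift_group = m + 2"
    unfolding derived_length_def
  proof (rule Least_equality)
    show "(derived lift_group ^^ (m + 2)) (carrier lift_group) = {\<one>\<^bsub>lift_group\<^esub>}"
      using top by (simp add: D_def)
    fix k assume k: "(derived lift_group ^^ k) (carrier lift_group) = {\<one>\<^bsub>lift_group\<^esub>}"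
    show "m + 2 \<le> k"
    proof (rule ccontr)
      assume "\<not> m + 2 \<le> k"
      then have "D (Suc m) = {\<one>\<^bsub>lift_group\<^esub>}"
        using G.exp_of_derived_one[OF k, of "Suc m"] by (simp add: D_def)
      then show False using ne by simp
    qed
  qed
qed

end

section \<open>Torus actions induced from dihedral subgroups\<close>

text \<open>Induced actions live on a set of cosets, whereas \<open>torus_action\<close> numbers its
  coordinates; a bijection with an initial segment transports the structure. The second conclusion
  keeps track of elements that reverse an axis, which the derived length needs.\<close>

lemma torus_action_transfer:
  fixes P :: "('a, 'b) monoid_scheme" (structure) and I :: "'i set"
    and act :: "'a \<Rightarrow> 'i \<Rightarrow> 'i" and sg shift :: "'a \<Rightarrow> 'i \<Rightarrow> int"
  assumes P: "group P" "finite (carrier P)" and N: "0 < N" and I: "finite I"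
    and act_in: "\<And>g i. g \<in> carrier P \<Longrightarrow> i \<in> I \<Longrightarrow> act g i \<in> I"
    and act_one: "\<And>i. i \<in> I \<Longrightarrow> act \<one> i = i"
    and act_mult: "\<And>g h i. g \<in> carrier P \<Longrightarrow> h \<in> carrier P \<Longrightarrow> i \<in> I \<Longrightarrow> act (g \<otimes> h) i = act g (act h i)"
    and sg_cases: "\<And>g i. g \<in> carrier P \<Longrightarrow> i \<in> I \<Longrightarrow> sg g i = 1 \<or> sg g i = -1"
    and sg_mult: "\<And>g h i. g \<in> carrier P \<Longrightarrow> h \<in> carrier P \<Longrightarrow> i \<in> I \<Longrightarrow> sg (g \<otimes> h) i = sg g (act h i) * sg h i"
    and shift_mult: "\<And>g h i. g \<in> carrier P \<Longrightarrow> h \<in> carrier P \<Longrightarrow> i \<in> I \<Longrightarrow>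
      N dvd shift (g \<otimes> h) i - (shift g (act h i) + sg g (act h i) * shift h i)"
    and free: "\<And>g. g \<in> carrier P \<Longrightarrow> g \<noteq> \<one> \<Longrightarrow>
      \<exists>j::nat. \<exists>i\<in>I. act (g [^] j) i = i \<and> sg (g [^] j) i = 1 \<and> \<not> N dvd shift (g [^] j) i"
    and flip: "\<And>i. i \<in> I \<Longrightarrow> \<exists>s\<in>carrier P. act s i = i \<and> sg s i = -1"
  obtains d act' sg' shift' where "torus_action P d N act' sg' shift'"
    "\<And>g. \<exists>i\<in>I. act g i = i \<and> sg g i = -1 \<Longrightarrow> \<exists>i<d. act' g i = i \<and> sg' g i = -1"
proof -
  obtain e where e: "bij_betw e {0..<card I} I" using ex_bij_betw_nat_finite[OF I] by blast
  define c where "c = inv_into {0..<card I} e"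
  have c: "c i < card I" "e (c i) = i" if "i \<in> I" for i
    using bij_betwE[OF bij_betw_inv_into[OF e]] bij_betw_inv_into_right[OF e] that by (auto simp: c_def)
  have eI: "e n \<in> I" "c (e n) = n" if "n < card I" for n
    using bij_betwE[OF e] bij_betw_inv_into_left[OF e] that by (auto simp: c_def)
  interpret P: group P by (rule P)
  have "torus_action P (card I) N (\<lambda>g n. c (act g (e n))) (\<lambda>g n. sg g (e n)) (\<lambda>g n. shift g (e n))"
  proof
    show "\<exists>j::nat. \<exists>i<card I. c (act (g [^] j) (e i)) = i \<and> sg (g [^] j) (e i) = 1 \<and> \<not> N dvd shift (g [^] j) (e i)"
      if "g \<in> carrier P" "g \<noteq> \<one>" for g
      using free[OF that] c by metis
    show "\<exists>s\<in>carrier P. c (act s (e i)) = i \<and> sg s (e i) = - 1" if "i < card I" for i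
      using flip[OF eI(1)[OF that]] eI(2)[OF that] by metis
  qed (use P(2) N c eI act_in act_one act_mult sg_cases sg_mult shift_mult in simp_all)
  moreover have "\<exists>n<card I. c (act g (e n)) = n \<and> sg g (e n) = -1" if "\<exists>i\<in>I. act g i = i \<and> sg g i = -1" for g
    using that c by metis
  ultimately show thesis by (rule that)
qed

text \<open>\<open>p\<close> and \<open>s\<close> generate a dihedral group of order twice
  \<open>ord p\<close>, the Klein four-group if \<open>ord p\<close> is 2. The last condition
  separates rotations from reflections and so makes signs well defined.\<close>

locale dihedral_pair = group P for P (structure) +
  fixes p s
  assumes fin: "finite (carrier P)"
    and p: "p \<in> carrier P" "p \<noteq> \<one>" and s: "s \<in> carrier P" "s \<otimes> s = \<one>"
    and inverts: "s \<otimes> p \<otimes> s = inv p"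
    and not_rotation: "\<And>k::int. s \<noteq> p [^] k"
begin

text \<open>The element acting on a circle of length \<open>ord p\<close> by
  \<open>u \<mapsto> e * u + a\<close>, where \<open>p\<close> rotates by 1 and \<open>s\<close>
  negates; \<open>dih_mult\<close> is the composition of such maps.\<close>

definition dih :: "int \<Rightarrow> int \<Rightarrow> 'a" where
  "dih a e = p [^] a \<otimes> (if e = 1 then \<one> else s)"

text \<open>Equality of left cosets of the subgroup generated by \<open>p\<close> and
  \<open>s\<close>.\<close>

definition rel :: "'a \<Rightarrow> 'a \<Rightarrow> bool" where
  "rel x y \<longleftrightarrow> (\<exists>a. \<exists>e\<in>{1,-1}. x = y \<otimes> dih a e)"

text \<open>The representative of the coset \<open>x\<langle>p, s\<rangle>\<close>, normalised so that the subgroup itself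
  is represented by the identity.\<close>

definition rep :: "'a \<Rightarrow> 'a" where
  "rep x = (if rel x \<one> then \<one> else SOME y. y \<in> carrier P \<and> rel x y)"

text \<open>\<open>ang x\<close> and \<open>sgn x\<close> are the coordinates of \<open>x\<close>
  relative to the representative of its coset. The angle is determined only modulo
  \<open>ord p\<close>, hence the choice.\<close>

definition ang :: "'a \<Rightarrow> int" where
  "ang x = (SOME a. \<exists>e\<in>{1,-1}. x = rep x \<otimes> dih a e)"

definition sgn :: "'a \<Rightarrow> int" where
  "sgn x = (SOME e. e \<in> {1,-1} \<and> x = rep x \<otimes> dih (ang x) e)"

section \<open>Arithmetic of the dihedral subgroup\<close>

lemma dih_carrier [simp]: "dih a e \<in> carrier P"
  using p s by (simp add: dih_def)

lemma s_pow: "s \<otimes> p [^] (k::int) = p [^] (-k) \<otimes> s"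
proof -
  have sp: "s \<otimes> p = inv p \<otimes> s"
    using inverts p s by (metis inv_closed inv_equality inv_solve_right' m_closed)
  have si: "s \<otimes> inv p = p \<otimes> s"
    using sp p s by (metis inv_closed inv_solve_left' inv_solve_right m_assoc m_closed)
  show ?thesis
  proof (induction k rule: int_induct[where k = 0])
    case (step1 i)
    have "s \<otimes> p [^] (i + 1) = s \<otimes> p [^] i \<otimes> p" using p s by (simp add: int_pow_mult m_assoc)
    also have "\<dots> = p [^] (- i) \<otimes> inv p \<otimes> s" using step1 p s sp by (simp add: m_assoc)
    also have "p [^] (- i) \<otimes> inv p = p [^] (- (i + 1))"
      using p by (simp add: int_pow_diff int_pow_neg)
    finally show ?case .
  next
    case (step2 i)
    have "s \<otimes> p [^] (i - 1) = s \<otimes> p [^] i \<otimes> inv p" using p s by (simp add: int_pow_diff m_assoc)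
    also have "\<dots> = p [^] (- i) \<otimes> p \<otimes> s" using step2 p s si by (simp add: m_assoc)
    also have "p [^] (- i) \<otimes> p = p [^] (- (i - 1))"
      using p int_pow_mult[of p "- i" 1] by (simp add: add.commute)
    finally show ?case .
  qed (use s in simp)
qed

lemma dih_mult:
  assumes "e \<in> {1,-1}" "f \<in> {1,-1}"
  shows "dih a e \<otimes> dih b f = dih (a + e * b) (e * f)"
proof (cases "e = 1")
  case True
  then show ?thesis using p s by (simp add: dih_def int_pow_mult m_assoc)
next
  case False
  then have e: "e = -1" using assms by simp
  let ?x = "if f = 1 then \<one> else s"
  have x: "?x \<in> carrier P" using s by simp
  have "dih a e \<otimes> dih b f = p [^] a \<otimes> (s \<otimes> p [^] b) \<otimes> ?x"
    using p s x by (simp add: dih_def e m_assoc)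
  also have "\<dots> = p [^] a \<otimes> p [^] (-b) \<otimes> (s \<otimes> ?x)"
    using p s x by (simp add: s_pow m_assoc)
  also have "p [^] a \<otimes> p [^] (-b) = p [^] (a - b)" using p by (simp add: int_pow_mult[symmetric])
  also have "s \<otimes> ?x = (if e * f = 1 then \<one> else s)" using assms(2) s e by auto
  finally show ?thesis by (simp add: dih_def e)
qed

lemma dih_eq_iff:
  assumes "e \<in> {1,-1}" "f \<in> {1,-1}"
  shows "dih a e = dih b f \<longleftrightarrow> e = f \<and> int (ord p) dvd a - b"
proof -
  have *: "p [^] a \<otimes> s \<noteq> p [^] b" for a b :: int
  proof
    assume "p [^] a \<otimes> s = p [^] b"
    then have "s = inv (p [^] a) \<otimes> p [^] b" using p s by (metis int_pow_closed inv_solve_left)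
    then have "s = p [^] (- a + b)" using p by (simp only: int_pow_mult int_pow_neg)
    then show False using not_rotation by blast
  qed
  have "p [^] a = p [^] b \<longleftrightarrow> int (ord p) dvd a - b"
    using int_pow_eq[OF p(1), of b a] by metis
  then show ?thesis
    using assms p s *[of a b] *[of b a, symmetric] by (auto simp: dih_def)
qed

lemma dih_zero_one [simp]: "dih 0 1 = \<one>"
  by (simp add: dih_def)

lemma dih_inverse:
  assumes "e \<in> {1,-1}"
  shows "dih a e \<otimes> dih (- e * a) e = \<one>"
  using dih_mult[OF assms assms, of a "- e * a"] assms by auto

section \<open>Cosets of the dihedral subgroup and their coordinates\<close>

lemma rel_refl: "x \<in> carrier P \<Longrightarrow> rel x x"
  unfolding rel_def by (intro exI[of _ 0] bexI[of _ 1]) auto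

lemma rel_sym:
  assumes "x \<in> carrier P" "y \<in> carrier P" "rel x y"
  shows "rel y x"
proof -
  obtain a e where e: "e \<in> {1,-1}" "x = y \<otimes> dih a e" using assms(3) by (auto simp: rel_def)
  then have "y = x \<otimes> dih (- e * a) e"
    using assms dih_inverse[OF e(1)] by (simp add: m_assoc)
  then show ?thesis using e(1) by (auto simp: rel_def)
qed

lemma rel_trans:
  assumes "z \<in> carrier P" "rel x y" "rel y z"
  shows "rel x z"
proof -
  obtain a e b f where e: "e \<in> {1,-1}" "x = y \<otimes> dih a e" and f: "f \<in> {1,-1}" "y = z \<otimes> dih b f"
    using assms(2,3) by (auto simp: rel_def)
  then have "x = z \<otimes> dih (b + f * a) (f * e)"
    using assms(1) dih_mult[OF f(1) e(1)] by (simp add: m_assoc)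
  moreover have "f * e \<in> {1,-1}" using e(1) f(1) by auto
  ultimately show ?thesis unfolding rel_def by blast
qed

lemma rel_mult: "g \<in> carrier P \<Longrightarrow> y \<in> carrier P \<Longrightarrow> rel x y \<Longrightarrow> rel (g \<otimes> x) (g \<otimes> y)"
  by (auto simp: rel_def m_assoc)

lemma rep:
  assumes "x \<in> carrier P"
  shows "rep x \<in> carrier P" "rel x (rep x)"
proof -
  have "rep x \<in> carrier P \<and> rel x (rep x)"
    unfolding rep_def using someI[of "\<lambda>y. y \<in> carrier P \<and> rel x y" x] rel_refl[OF assms] assms by auto
  then show "rep x \<in> carrier P" "rel x (rep x)" by auto
qed

lemma rep_cong:
  assumes "x \<in> carrier P" "y \<in> carrier P" "rel x y"
  shows "rep x = rep y"
proof -
  have eq: "rel x z = rel y z" if "z \<in> carrier P" for z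
    using rel_trans[OF that rel_sym[OF assms]] rel_trans[OF that assms(3)] by blast
  have e: "(\<lambda>z. z \<in> carrier P \<and> rel x z) = (\<lambda>z. z \<in> carrier P \<and> rel y z)"
    using eq by (intro ext) blast
  show ?thesis unfolding rep_def eq[OF one_closed] e by (rule refl)
qed

lemma rep_one [simp]: "rep \<one> = \<one>"
  by (simp add: rep_def rel_refl)

lemma rep_rep: "x \<in> carrier P \<Longrightarrow> rep (rep x) = rep x"
  using rep_cong rep by metis

lemma sgn_ang:
  assumes "x \<in> carrier P"
  shows "sgn x \<in> {1,-1}" "x = rep x \<otimes> dih (ang x) (sgn x)"
proof -
  have "\<exists>a. \<exists>e\<in>{1,-1}. x = rep x \<otimes> dih a e" using rep[OF assms] by (simp add: rel_def)
  then have "\<exists>e\<in>{1,-1}. x = rep x \<otimes> dih (ang x) e" unfolding ang_def by (rule someI_ex)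
  then have "sgn x \<in> {1,-1} \<and> x = rep x \<otimes> dih (ang x) (sgn x)"
    unfolding sgn_def using someI_ex[of "\<lambda>e. e \<in> {1,-1} \<and> x = rep x \<otimes> dih (ang x) e"] by blast
  then show "sgn x \<in> {1,-1}" "x = rep x \<otimes> dih (ang x) (sgn x)" by auto
qed

lemma sgn_ang_unique:
  assumes "x \<in> carrier P" "e \<in> {1,-1}" "x = rep x \<otimes> dih a e"
  shows "sgn x = e" "int (ord p) dvd ang x - a"
proof -
  have "rep x \<otimes> dih (ang x) (sgn x) = rep x \<otimes> dih a e"
    using sgn_ang(2)[OF assms(1)] assms(3) by simp
  then have "dih (ang x) (sgn x) = dih a e" using rep(1)[OF assms(1)] by simp
  then show "sgn x = e" "int (ord p) dvd ang x - a"
    using dih_eq_iff[OF sgn_ang(1)[OF assms(1)] assms(2)] by auto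
qed

text \<open>This is the cocycle of an induced action: \<open>g\<close> moves the coset of
  \<open>x\<close> to that of \<open>g \<otimes> x\<close>, and multiplying the decompositions of
  \<open>x\<close> and of \<open>g \<otimes> rep x\<close> composes their affine maps. It supplies
  the three multiplication laws of \<open>torus_action\<close>.\<close>

lemma cocycle:
  assumes g: "g \<in> carrier P" and x: "x \<in> carrier P"
  shows "rep (g \<otimes> x) = rep (g \<otimes> rep x)" "sgn (g \<otimes> x) = sgn (g \<otimes> rep x) * sgn x"
    "int (ord p) dvd ang (g \<otimes> x) - (ang (g \<otimes> rep x) + sgn (g \<otimes> rep x) * ang x)"
proof -
  show r: "rep (g \<otimes> x) = rep (g \<otimes> rep x)"
    using g x rep[OF x] rel_mult by (intro rep_cong) auto
  let ?y = "g \<otimes> rep x"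
  have y: "?y \<in> carrier P" using g rep(1)[OF x] by simp
  have "g \<otimes> x = ?y \<otimes> dih (ang x) (sgn x)"
    using sgn_ang(2)[OF x] g rep(1)[OF x] by (metis dih_carrier m_assoc)
  also have "\<dots> = rep ?y \<otimes> (dih (ang ?y) (sgn ?y) \<otimes> dih (ang x) (sgn x))"
    using sgn_ang(2)[OF y] rep(1)[OF y] by (metis dih_carrier m_assoc)
  finally have e: "g \<otimes> x = rep (g \<otimes> x) \<otimes> dih (ang ?y + sgn ?y * ang x) (sgn ?y * sgn x)"
    using dih_mult sgn_ang(1)[OF x] sgn_ang(1)[OF y] r by simp
  have "sgn ?y * sgn x \<in> {1,-1}" using sgn_ang(1)[OF x] sgn_ang(1)[OF y] by auto
  then show "sgn (g \<otimes> x) = sgn ?y * sgn x"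
    "int (ord p) dvd ang (g \<otimes> x) - (ang ?y + sgn ?y * ang x)"
    using sgn_ang_unique[OF _ _ e] g x by auto
qed

text \<open>Since \<open>r \<otimes> s\<close> is \<open>r\<close> times a reflection, the conjugate
  of \<open>s\<close> by \<open>r\<close> reverses the coordinate belonging to
  \<open>r\<close>.\<close>

lemma fixed_rep:
  assumes "r \<in> carrier P" "rep r = r"
  shows "rep (r \<otimes> s) = r" "sgn (r \<otimes> s) = -1"
proof -
  have e: "r \<otimes> s = r \<otimes> dih 0 (-1)" using s by (simp add: dih_def)
  then have "rel (r \<otimes> s) r" by (auto simp: rel_def)
  then show r: "rep (r \<otimes> s) = r" using rep_cong[of "r \<otimes> s" r] assms s by simp
  show "sgn (r \<otimes> s) = -1" using sgn_ang_unique(1)[of "r \<otimes> s" "-1" 0] e r assms s by simp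
qed

text \<open>On the coordinate of the trivial coset, \<open>p\<close> rotates by 1 modulo
  \<open>ord p\<close>; this is nonzero because \<open>p \<noteq> \<one>\<close>.\<close>

lemma rotation:
  shows "rep p = \<one>" "sgn p = 1" "int (ord p) dvd ang p - 1"
proof -
  have e: "p = \<one> \<otimes> dih 1 1" using p by (simp add: dih_def)
  then have "rel p \<one>" unfolding rel_def by blast
  then show r: "rep p = \<one>" using rep_cong[of p \<one>] p by simp
  show "sgn p = 1" "int (ord p) dvd ang p - 1"
    using sgn_ang_unique[of p 1 1] e r p by auto
qed

end

text \<open>All dihedral pairs are used at once: each contributes coordinates indexed by its cosets,
  with the action induced from the circle. A power of \<open>g\<close> that is the \<open>p\<close>
  of some pair then rotates the coordinate of the trivial coset, which gives freeness.\<close>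

theorem exists_torus_action:
  fixes P :: "('a, 'b) monoid_scheme" (structure)
  assumes P: "group P" "finite (carrier P)"
    and rot: "\<And>g. g \<in> carrier P \<Longrightarrow> g \<noteq> \<one> \<Longrightarrow> \<exists>j::nat. \<exists>s. dihedral_pair P (g [^] j) s"
  obtains d N act sg shift where "torus_action P d N act sg shift"
    "\<And>p s. dihedral_pair P p s \<Longrightarrow> \<exists>i<d. act s i = i \<and> sg s i = -1"
proof -
  interpret P: group P by (rule P)
  define I where "I = {((p, s), r). dihedral_pair P p s \<and> r \<in> carrier P \<and> dihedral_pair.rep P p s r = r}"
  define act where "act = (\<lambda>g ((p, s), r). ((p, s), dihedral_pair.rep P p s (g \<otimes> r)))"
  define sg where "sg = (\<lambda>g ((p, s), r). dihedral_pair.sgn P p s (g \<otimes> r))"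
  define N where "N = int (Coset.order P)"
  \<comment> \<open>The circle of a pair has length \<open>ord p\<close>; the factor rescales it to
    the common length \<open>N\<close>, the order of the group.\<close>
  define shift where "shift = (\<lambda>g ((p, s), r). dihedral_pair.ang P p s (g \<otimes> r) * (N div int (P.ord p)))"
  have N0: "0 < N" using P.order_gt_0_iff_finite P(2) by (simp add: N_def)
  have ord: "N = int (P.ord p) * (N div int (P.ord p))" if "p \<in> carrier P" for p
    using P.ord_dvd_group_order[OF that] by (simp add: N_def)
  have "I \<subseteq> (carrier P \<times> carrier P) \<times> carrier P"
    by (auto simp: I_def dihedral_pair_def dihedral_pair_axioms_def)
  then have fI: "finite I" using P(2) by (meson finite_SigmaI finite_subset)
  have one_in: "((p, s), \<one>) \<in> I" if "dihedral_pair P p s" for p s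
    using dihedral_pair.rep_one[OF that] that by (simp add: I_def)
  show thesis
  proof (rule torus_action_transfer[OF P N0 fI, of act sg shift])
    fix g i assume g: "g \<in> carrier P" and i: "i \<in> I"
    obtain p s r where ie: "i = ((p, s), r)" by (metis prod.exhaust)
    interpret D: dihedral_pair P p s using i ie by (simp add: I_def)
    have r: "r \<in> carrier P" "D.rep r = r" using i ie by (auto simp: I_def)
    show "act g i \<in> I"
      using g r D.rep(1)[of "g \<otimes> r"] D.rep_rep D.dihedral_pair_axioms by (simp add: I_def act_def ie)
    show "sg g i = 1 \<or> sg g i = -1"
      using g r D.sgn_ang(1)[of "g \<otimes> r"] by (simp add: sg_def ie)
  next
    fix i assume i: "i \<in> I"
    obtain p s r where ie: "i = ((p, s), r)" by (metis prod.exhaust)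
    interpret D: dihedral_pair P p s using i ie by (simp add: I_def)
    have r: "r \<in> carrier P" "D.rep r = r" using i ie by (auto simp: I_def)
    show "act \<one> i = i" using r by (simp add: act_def ie)
    have "r \<otimes> s \<otimes> inv r \<otimes> r = r \<otimes> s" using r D.s by (simp add: P.m_assoc)
    then show "\<exists>s\<in>carrier P. act s i = i \<and> sg s i = -1"
      using D.fixed_rep[OF r] r D.s by (intro bexI[of _ "r \<otimes> s \<otimes> inv r"]) (simp_all add: act_def sg_def ie)
  next
    fix g h i assume g: "g \<in> carrier P" and h: "h \<in> carrier P" and i: "i \<in> I"
    obtain p s r where ie: "i = ((p, s), r)" by (metis prod.exhaust)
    interpret D: dihedral_pair P p s using i ie by (simp add: I_def)
    have r: "r \<in> carrier P" "D.rep r = r" using i ie by (auto simp: I_def)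
    have hr: "h \<otimes> r \<in> carrier P" "g \<otimes> h \<otimes> r = g \<otimes> (h \<otimes> r)" using g h r by (simp_all add: P.m_assoc)
    note c = D.cocycle[OF g hr(1)]
    show "act (g \<otimes> h) i = act g (act h i)" using c(1) by (simp add: act_def ie hr)
    show "sg (g \<otimes> h) i = sg g (act h i) * sg h i" using c(2) by (simp add: act_def sg_def ie hr)
    obtain k where "D.ang (g \<otimes> (h \<otimes> r)) - (D.ang (g \<otimes> D.rep (h \<otimes> r)) + D.sgn (g \<otimes> D.rep (h \<otimes> r)) * D.ang (h \<otimes> r)) = int (P.ord p) * k"
      using c(3) by blast
    then have "shift (g \<otimes> h) i - (shift g (act h i) + sg g (act h i) * shift h i) = int (P.ord p) * k * (N div int (P.ord p))"
      unfolding shift_def act_def sg_def ie prod.case hr(2) by (metis (no_types) distrib_right left_diff_distrib mult.assoc)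
    also have "\<dots> = N * k" using ord[OF D.p(1)] by (metis mult.assoc mult.commute)
    finally show "N dvd shift (g \<otimes> h) i - (shift g (act h i) + sg g (act h i) * shift h i)" by simp
  next
    fix g assume g: "g \<in> carrier P" "g \<noteq> \<one>"
    obtain j :: nat and s where js: "dihedral_pair P (g [^] j) s" using rot[OF g] by blast
    define p where "p = g [^] j"
    interpret D: dihedral_pair P p s using js by (simp add: p_def)
    have "\<not> N dvd D.ang p * (N div int (P.ord p))"
    proof
      have o: "int (P.ord p) > 0" "N div int (P.ord p) > 0"
        using ord[OF D.p(1)] N0
        by (metis less_irrefl mult_zero_left of_nat_0_eq_iff of_nat_0_less_iff gr0I, metis of_nat_0_le_iff less_le_not_le zero_less_mult_iff)
      assume "N dvd D.ang p * (N div int (P.ord p))"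
      then have "int (P.ord p) * (N div int (P.ord p)) dvd D.ang p * (N div int (P.ord p))"
        using ord[OF D.p(1)] by simp
      then have "int (P.ord p) dvd D.ang p" using o by simp
      \<comment> \<open>The angle of \<open>p\<close> is 1 modulo \<open>ord p\<close>, so
        divisibility would give \<open>ord p = 1\<close>.\<close>
      then have "int (P.ord p) dvd 1" using D.rotation(3) by (metis dvd_diff diff_diff_eq2 add_diff_cancel_left')
      then show False using P.ord_eq_1[OF D.p(1)] D.p(2) o by simp
    qed
    then show "\<exists>j::nat. \<exists>i\<in>I. act (g [^] j) i = i \<and> sg (g [^] j) i = 1 \<and> \<not> N dvd shift (g [^] j) i"
      using D.rotation(1,2) D.p(1) one_in[OF D.dihedral_pair_axioms]
      by (intro exI[of _ j] bexI[of _ "((p, s), \<one>)"]) (simp_all add: act_def sg_def shift_def p_def[symmetric])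
  next
    fix d act' sg' shift'
    assume ta: "torus_action P d N act' sg' shift'"
      and *: "\<And>g. \<exists>i\<in>I. act g i = i \<and> sg g i = -1 \<Longrightarrow> \<exists>i<d. act' g i = i \<and> sg' g i = -1"
    have "\<exists>i<d. act' s i = i \<and> sg' s i = -1" if ps: "dihedral_pair P p s" for p s
    proof -
      interpret D: dihedral_pair P p s by (rule ps)
      show ?thesis
        using D.fixed_rep[of \<one>] D.s(1) one_in[OF ps]
        by (intro * bexI[of _ "((p, s), \<one>)"]) (simp_all add: act_def sg_def)
    qed
    then show thesis using that ta by blast
  qed
qed

section \<open>Groups with many dihedral pairs\<close>

abbreviation C2 :: "int monoid" where "C2 \<equiv> integer_mod_group 2"

lemma carrier_C2: "carrier C2 = {0, 1}"
  by (auto simp: carrier_integer_mod_group)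

lemma pow_DirProd: "(g, h) [^]\<^bsub>G \<times>\<times> H\<^esub> (n::nat) = (g [^]\<^bsub>G\<^esub> n, h [^]\<^bsub>H\<^esub> n)"
  by (induction n) simp_all

lemma DirProd_fst_hom: "group G \<Longrightarrow> group H \<Longrightarrow> group_hom (G \<times>\<times> H) G fst"
  by (auto simp: group_hom_def group_hom_axioms_def hom_def DirProd_group)

lemma DirProd_snd_hom: "group G \<Longrightarrow> group H \<Longrightarrow> group_hom (G \<times>\<times> H) H snd"
  by (auto simp: group_hom_def group_hom_axioms_def hom_def DirProd_group)

lemma (in group) int_pow_involution:
  assumes "p \<in> carrier G" "p \<otimes> p = \<one>"
  shows "p [^] (k::int) \<in> {\<one>, p}"
proof -
  have "p [^] (2 * m :: int) = \<one>" for m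
    using assms int_pow_pow[of p 2 m] int_pow_mult[of p 1 1] by simp
  then have "p [^] (2 * (k div 2)) \<otimes> p [^] (k mod 2) \<in> {\<one>, p}"
    using assms(1) by (cases "k mod 2 = 0") (auto simp: not_mod_2_eq_0_eq_1)
  then show ?thesis using assms(1) by (simp add: int_pow_mult[symmetric])
qed

text \<open>Two distinct commuting involutions generate a Klein four-group; here \<open>p\<close> is
  its own inverse and its only powers are \<open>\<one>\<close> and \<open>p\<close>.\<close>

lemma (in group) dihedral_pair_commuting:
  assumes "finite (carrier G)" "p \<in> carrier G" "s \<in> carrier G" "p \<otimes> p = \<one>" "s \<otimes> s = \<one>"
    "s \<otimes> p = p \<otimes> s" "p \<noteq> \<one>" "s \<noteq> \<one>" "s \<noteq> p"
  shows "dihedral_pair G p s"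
proof
  have "s \<otimes> p \<otimes> s = p" using assms by (simp add: m_assoc)
  then show "s \<otimes> p \<otimes> s = inv p" using assms inv_equality by metis
  show "s \<noteq> p [^] k" for k :: int using int_pow_involution[of p k] assms by auto
qed (use assms in auto)

text \<open>If \<open>s\<close> were a power of \<open>p\<close>, it would commute with
  \<open>p\<close>; then \<open>s \<otimes> p \<otimes> s\<close> would be \<open>p\<close>, forcing
  \<open>p \<otimes> p = \<one>\<close>.\<close>

lemma (in group) dihedral_pair_noncommuting:
  assumes "finite (carrier G)" "p \<in> carrier G" "s \<in> carrier G" "s \<otimes> s = \<one>"
    "s \<otimes> p \<otimes> s = inv p" "p \<otimes> p \<noteq> \<one>"
  shows "dihedral_pair G p s"
proof
  show "s \<noteq> p [^] k" for k :: int
  proof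
    assume s: "s = p [^] k"
    then have "s \<otimes> p = p \<otimes> s"
      using assms(2) int_pow_mult[of p k 1] int_pow_mult[of p 1 k] by (simp add: add.commute)
    then have "inv p = p" using assms by (metis m_assoc r_one)
    then show False using assms by (metis r_inv)
  qed
qed (use assms in auto)

text \<open>These conditions on \<open>Q\<close> yield enough dihedral pairs in
  \<open>Q \<times>\<times> C2\<close>. In the last one \<open>s\<close> may be
  \<open>\<one>\<close>, which covers powers that are involutions; \<open>z\<close> serves as the
  partner of the generator of \<open>C2\<close>.\<close>

locale inverting_group = Q?: group Q for Q (structure) +
  fixes z
  assumes finite_Q: "finite (carrier Q)"
    and z: "z \<in> carrier Q" "z \<noteq> \<one>" "z \<otimes> z = \<one>"
    and inverted: "\<And>x. x \<in> carrier Q \<Longrightarrow> x \<noteq> \<one> \<Longrightarrow>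
      \<exists>j::nat. \<exists>s\<in>carrier Q. x [^] j \<noteq> \<one> \<and> s \<otimes> s = \<one> \<and> s \<otimes> x [^] j \<otimes> s = inv (x [^] j)"
begin

lemma group_prod: "group (Q \<times>\<times> C2)"
  by (simp add: DirProd_group Q.is_group)

lemma finite_prod: "finite (carrier (Q \<times>\<times> C2))"
  using finite_Q by (simp add: carrier_C2)

lemma prod_rotation:
  assumes g: "g \<in> carrier (Q \<times>\<times> C2)" "g \<noteq> \<one>\<^bsub>Q \<times>\<times> C2\<^esub>"
  shows "\<exists>j::nat. \<exists>s. dihedral_pair (Q \<times>\<times> C2) (g [^]\<^bsub>Q \<times>\<times> C2\<^esub> j) s"
proof -
  interpret P: group "Q \<times>\<times> C2" by (rule group_prod)
  obtain x c where xc: "g = (x, c)" "x \<in> carrier Q" "c \<in> {0, 1}" using g(1) by (auto simp: carrier_C2)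
  show ?thesis
  proof (cases "x = \<one>")
    \<comment> \<open>Here \<open>g\<close> is the generator of \<open>C2\<close>, paired with the
      commuting involution \<open>(z, 0)\<close>; the exponent is 1.\<close>
    case True
    then have "c = 1" using g(2) xc by auto
    then have "dihedral_pair (Q \<times>\<times> C2) g (z, 0)"
      using True xc z by (intro P.dihedral_pair_commuting finite_prod) (auto simp: carrier_C2)
    then show ?thesis using P.nat_pow_eone[OF g(1)] by metis
  next
    case False
    then obtain j :: nat and s where s: "s \<in> carrier Q" "x [^] j \<noteq> \<one>" "s \<otimes> s = \<one>"
      "s \<otimes> x [^] j \<otimes> s = inv (x [^] j)" using inverted xc(2) by blast
    define y where "y = x [^] j"
    define b where "b = c [^]\<^bsub>C2\<^esub> j"
    have y: "y \<in> carrier Q" using xc(2) by (simp add: y_def)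
    have b: "b \<in> {0, 1}" unfolding b_def by auto
    have gj: "g [^]\<^bsub>Q \<times>\<times> C2\<^esub> j = (y, b)" by (simp add: xc(1) pow_DirProd y_def b_def)
    have P: "(y, b) \<in> carrier (Q \<times>\<times> C2)" using y b by (auto simp: carrier_C2)
    \<comment> \<open>If \<open>y\<close> is an involution, the generator of \<open>C2\<close> is a
      commuting partner of \<open>(y, b)\<close>. Otherwise \<open>s\<close> inverts
      \<open>y\<close>, and \<open>b\<close> is its own inverse in \<open>C2\<close>.\<close>
    have "\<exists>s'. dihedral_pair (Q \<times>\<times> C2) (y, b) s'"
    proof (cases "y \<otimes> y = \<one>")
      case True
      have "dihedral_pair (Q \<times>\<times> C2) (y, b) (\<one>, 1)"
        using True s(2) P y b by (intro P.dihedral_pair_commuting finite_prod) (auto simp: carrier_C2 y_def[symmetric])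
      then show ?thesis by blast
    next
      case False
      have "inv\<^bsub>Q \<times>\<times> C2\<^esub> (y, b) = (inv y, b)"
        using b y by (subst inv_DirProd) (auto simp: Q.is_group carrier_C2)
      then have "dihedral_pair (Q \<times>\<times> C2) (y, b) (s, 0)"
        using False s P b by (intro P.dihedral_pair_noncommuting finite_prod) (auto simp: carrier_C2 y_def[symmetric])
      then show ?thesis by blast
    qed
    then show ?thesis using gj by metis
  qed
qed

text \<open>Some commuting involution differs from \<open>y\<close>: \<open>(z, 0)\<close> if
  \<open>y\<close> lies in the factor \<open>C2\<close>, and the generator of \<open>C2\<close>
  otherwise. This lets a prescribed involution reverse an axis in the derived length
  argument.\<close>

lemma prod_reflection:
  assumes y: "y \<in> carrier (Q \<times>\<times> C2)" "y \<noteq> \<one>\<^bsub>Q \<times>\<times> C2\<^esub>" "y \<otimes>\<^bsub>Q \<times>\<times> C2\<^esub> y = \<one>\<^bsub>Q \<times>\<times> C2\<^esub>"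
  shows "\<exists>p. dihedral_pair (Q \<times>\<times> C2) p y"
proof -
  interpret P: group "Q \<times>\<times> C2" by (rule group_prod)
  obtain q c where qc: "y = (q, c)" "q \<in> carrier Q" "c \<in> {0, 1}" using y(1) by (auto simp: carrier_C2)
  have "dihedral_pair (Q \<times>\<times> C2) (if q = \<one> then (z, 0) else (\<one>, 1)) y"
    using y qc z by (intro P.dihedral_pair_commuting finite_prod) (auto simp: carrier_C2)
  then show ?thesis by blast
qed

text \<open>The homomorphism \<open>f\<close> is the projection \<open>holonomy\<close>. In the last
  conclusion \<open>prod_reflection\<close> makes the involution \<open>y\<close> the reflection of
  a dihedral pair, so \<open>y\<close> reverses a coordinate axis.\<close>

theorem exists_Bieberbach:
  obtains G f where "Bieberbach_group G" "finite_generalized_exponent G"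
    "group_hom G (Q \<times>\<times> C2) f" "f ` carrier G = carrier (Q \<times>\<times> C2)"
    "\<And>m y. (derived (Q \<times>\<times> C2) ^^ Suc m) (carrier (Q \<times>\<times> C2)) = {\<one>\<^bsub>Q \<times>\<times> C2\<^esub>} \<Longrightarrow>
      y \<in> (derived (Q \<times>\<times> C2) ^^ m) (carrier (Q \<times>\<times> C2)) \<Longrightarrow> y \<noteq> \<one>\<^bsub>Q \<times>\<times> C2\<^esub> \<Longrightarrow>
      y \<otimes>\<^bsub>Q \<times>\<times> C2\<^esub> y = \<one>\<^bsub>Q \<times>\<times> C2\<^esub> \<Longrightarrow> solvable G \<and> derived_length G = m + 2"
proof -
  interpret P: group "Q \<times>\<times> C2" by (rule group_prod)
  obtain d N act sg shift where ta: "torus_action (Q \<times>\<times> C2) d N act sg shift"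
    and r: "\<And>p s. dihedral_pair (Q \<times>\<times> C2) p s \<Longrightarrow> \<exists>i<d. act s i = i \<and> sg s i = -1"
    using exists_torus_action[OF group_prod finite_prod prod_rotation] by metis
  interpret T: torus_action "Q \<times>\<times> C2" d N act sg shift by (rule ta)
  show thesis
  proof (rule that[OF T.Bieberbach_lift_group T.finite_generalized_exponent_lift_group T.holonomy_hom T.holonomy_surj])
    fix m y
    assume m: "(derived (Q \<times>\<times> C2) ^^ Suc m) (carrier (Q \<times>\<times> C2)) = {\<one>\<^bsub>Q \<times>\<times> C2\<^esub>}"
      and y: "y \<in> (derived (Q \<times>\<times> C2) ^^ m) (carrier (Q \<times>\<times> C2))" "y \<noteq> \<one>\<^bsub>Q \<times>\<times> C2\<^esub>"
        "y \<otimes>\<^bsub>Q \<times>\<times> C2\<^esub> y = \<one>\<^bsub>Q \<times>\<times> C2\<^esub>"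
    have "y \<in> carrier (Q \<times>\<times> C2)" using y(1) P.exp_of_derived_in_carrier[OF subset_refl] by blast
    then obtain p where "dihedral_pair (Q \<times>\<times> C2) p y" using prod_reflection y(2,3) by blast
    then obtain i where "i < d" "act y i = i" "sg y i = -1" using r by blast
    then show "solvable T.lift_group \<and> derived_length T.lift_group = m + 2"
      using T.derived_length_lift_group[OF m y(1)] by blast
  qed
qed

end

text \<open>The order of \<open>x\<close> is a power of 2 greater than 1, and half of it is the
  exponent sought.\<close>

lemma (in group) exists_power_involution:
  assumes x: "x \<in> carrier G" "x \<noteq> \<one>" and card: "card (carrier G) = 2 ^ k"
  shows "\<exists>j::nat. x [^] j \<noteq> \<one> \<and> x [^] j \<otimes> x [^] j = \<one>"
proof -
  have "ord x dvd 2 ^ k" using ord_dvd_group_order[OF x(1)] card by (simp add: Coset.order_def)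
  then obtain m where m: "ord x = 2 ^ m" using divides_primepow_nat[OF two_is_prime_nat] by blast
  then obtain n where n: "m = Suc n" using x ord_eq_1 by (cases m) auto
  have "x [^] (2 ^ n :: nat) \<noteq> \<one>"
    using pow_eq_id[OF x(1), of "2 ^ n"] m n by (auto dest: dvd_imp_le)
  moreover have "x [^] (2 ^ n :: nat) \<otimes> x [^] (2 ^ n :: nat) = \<one>"
    using pow_ord_eq_1[OF x(1)] x(1) by (simp add: nat_pow_mult m n mult_2)
  ultimately show ?thesis by blast
qed

text \<open>Every nontrivial element has a power that is an involution; that power is its own
  inverse, so \<open>s = \<one>\<close> inverts it.\<close>

lemma (in group) inverting_group_if_two_group:
  assumes "finite (carrier G)" "card (carrier G) = 2 ^ k" "carrier G \<noteq> {\<one>}"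
  obtains z where "inverting_group G z"
proof -
  obtain x where x: "x \<in> carrier G" "x \<noteq> \<one>" using assms(3) one_closed by blast
  obtain j :: nat where j: "x [^] j \<noteq> \<one>" "x [^] j \<otimes> x [^] j = \<one>"
    using exists_power_involution[OF x assms(2)] by blast
  have "inverting_group G (x [^] j)"
  proof
    fix y assume y: "y \<in> carrier G" "y \<noteq> \<one>"
    obtain i :: nat where i: "y [^] i \<noteq> \<one>" "y [^] i \<otimes> y [^] i = \<one>"
      using exists_power_involution[OF y assms(2)] by blast
    then have "inv (y [^] i) = y [^] i" using y(1) by (intro inv_equality) auto
    then show "\<exists>j::nat. \<exists>s\<in>carrier G. y [^] j \<noteq> \<one> \<and> s \<otimes> s = \<one> \<and> s \<otimes> y [^] j \<otimes> s = inv (y [^] j)"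
      using i y(1) by (intro exI[of _ i] bexI[of _ \<one>]) auto
  qed (use assms x j in auto)
  then show thesis by (rule that)
qed

text \<open>The inverting involution reverses every cycle of \<open>x\<close> about a chosen base point.\<close>

lemma sym_group_inverted:
  assumes x: "x \<in> carrier (sym_group n)"
  shows "\<exists>s\<in>carrier (sym_group n). s \<otimes>\<^bsub>sym_group n\<^esub> s = \<one>\<^bsub>sym_group n\<^esub> \<and>
    s \<otimes>\<^bsub>sym_group n\<^esub> x \<otimes>\<^bsub>sym_group n\<^esub> s = inv\<^bsub>sym_group n\<^esub> x"
proof -
  interpret S: group "sym_group n" by (rule sym_group_is_group)
  define pw where "pw k = x [^]\<^bsub>sym_group n\<^esub> (k::int)" for k
  have add: "pw (a + b) u = pw a (pw b u)" for a b u
    using S.int_pow_mult[OF x, of a b] by (simp add: pw_def sym_group_mult)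
  have zero: "pw 0 u = u" for u by (simp add: pw_def sym_group_one)
  have one: "pw 1 = x" using x by (simp add: pw_def)
  have minus: "pw (-1) = inv\<^bsub>sym_group n\<^esub> x" using x S.int_pow_neg[OF x, of 1] by (simp add: pw_def)
  have out: "pw k u = u" if "u \<notin> {1..n}" for k u
    using S.int_pow_closed[OF x, of k] that by (auto simp: pw_def sym_group_carrier permutes_def)
  \<comment> \<open>\<open>r u\<close> is the base point of the cycle through \<open>u\<close>. The
    predicate chosen from depends only on the cycle, so \<open>r\<close> is constant on it.\<close>
  define r where "r u = (SOME v. \<exists>k. u = pw k v)" for u
  have r: "\<exists>k. u = pw k (r u)" for u
    unfolding r_def by (rule someI[of _ u]) (metis zero)
  have r_pw: "r (pw k u) = r u" for k u
  proof -
    have "(\<exists>l. pw k u = pw l v) \<longleftrightarrow> (\<exists>l. u = pw l v)" for v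
      by (metis add add.commute add.right_inverse zero)
    then show ?thesis by (simp add: r_def)
  qed
  define s where "s u = pw (- (SOME k. u = pw k (r u))) (r u)" for u
  \<comment> \<open>\<open>s\<close> sends \<open>pw k\<close> of the base point to
    \<open>pw (- k)\<close> of it. Two exponents reaching the same point differ by a period of the
    cycle, so the chosen one does not matter.\<close>
  have s: "s u = pw (- k) (r u)" if "u = pw k (r u)" for u k
  proof -
    let ?l = "SOME k. u = pw k (r u)"
    have l: "u = pw ?l (r u)" using r by (rule someI_ex)
    have "pw (- k) (r u) = pw (- k - ?l) (pw ?l (r u))" by (simp add: add[symmetric])
    also have "\<dots> = pw (- k - ?l) (pw k (r u))" using l that by simp
    also have "\<dots> = pw (- ?l) (r u)" by (simp add: add[symmetric])
    finally show ?thesis by (simp add: s_def)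
  qed
  have r_r: "r (r u) = r u" for u using r_pw r by metis
  have s_pw: "s (pw k (r u)) = pw (- k) (r u)" for k u
    using s[of "pw k (r u)" k] by (simp add: r_pw r_r)
  have ss: "s (s u) = u" for u
    using r[of u] s_pw by (metis add.inverse_inverse)
  have sxs: "s (x (s u)) = (inv\<^bsub>sym_group n\<^esub> x) u" for u
  proof -
    obtain k where k: "u = pw k (r u)" using r by blast
    have "x (s u) = pw (1 - k) (r u)" using s[OF k] add[of 1 "- k" "r u"] by (simp add: one)
    then have "s (x (s u)) = pw (-1 + k) (r u)" using s_pw[of "1 - k" u] by simp
    also have "\<dots> = (inv\<^bsub>sym_group n\<^esub> x) u" using add[of "-1" k "r u"] k minus by simp
    finally show ?thesis .
  qed
  \<comment> \<open>Points outside \<open>{1..n}\<close> are fixed by all powers of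
    \<open>x\<close>, hence are their own base points.\<close>
  have "s u = u" if "u \<notin> {1..n}" for u
  proof -
    obtain k where k: "u = pw k (r u)" using r by blast
    then have "r u = pw (- k) u" by (metis add add.left_inverse zero)
    then have "r u = u" using out[OF that] by simp
    then show ?thesis using s[OF k] out[OF that] by simp
  qed
  then have "s permutes {1..n}" unfolding permutes_def by (metis ss)
  then show ?thesis
    using ss sxs by (intro bexI[of _ s]) (auto simp: sym_group_mult sym_group_one sym_group_carrier fun_eq_iff)
qed

lemma inverting_group_sym_group:
  assumes "n \<ge> 2"
  obtains z where "inverting_group (sym_group n) z"
proof -
  interpret S: group "sym_group n" by (rule sym_group_is_group)
  let ?z = "Transposition.transpose 1 2 :: nat \<Rightarrow> nat"
  have z: "?z permutes {1..n}" using assms by (intro permutes_swap_id) auto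
  have "inverting_group (sym_group n) ?z"
  proof
    show "finite (carrier (sym_group n))"
      using finite_permutations[of "{1..n}"] by (simp add: sym_group_def)
    show "?z \<noteq> \<one>\<^bsub>sym_group n\<^esub>"
      unfolding sym_group_one by (metis id_apply numeral_eq_one_iff semiring_norm(85) transpose_apply_first)
    show "\<exists>j::nat. \<exists>s\<in>carrier (sym_group n). x [^]\<^bsub>sym_group n\<^esub> j \<noteq> \<one>\<^bsub>sym_group n\<^esub> \<and>
       s \<otimes>\<^bsub>sym_group n\<^esub> s = \<one>\<^bsub>sym_group n\<^esub> \<and>
       s \<otimes>\<^bsub>sym_group n\<^esub> x [^]\<^bsub>sym_group n\<^esub> j \<otimes>\<^bsub>sym_group n\<^esub> s = inv\<^bsub>sym_group n\<^esub> (x [^]\<^bsub>sym_group n\<^esub> j)"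
      if "x \<in> carrier (sym_group n)" "x \<noteq> \<one>\<^bsub>sym_group n\<^esub>" for x
      using sym_group_inverted[OF that(1)] that by (intro exI[of _ 1]) simp
  qed (use z in \<open>simp_all add: sym_group_carrier sym_group_mult sym_group_one\<close>)
  then show thesis by (rule that)
qed

section \<open>2-groups of prescribed derived length\<close>

text \<open>The wreath product of \<open>W\<close> with the group of order 2, whose nontrivial
  element \<open>True\<close> exchanges the two factors; \<open>t \<noteq> t'\<close> is addition
  modulo 2.\<close>

definition swap_wreath :: "('a, 'b) monoid_scheme \<Rightarrow> ('a \<times> 'a \<times> bool) monoid" where
  "swap_wreath W = \<lparr>carrier = carrier W \<times> carrier W \<times> UNIV,
     monoid.mult = (\<lambda>(a, b, t) (a', b', t').
       (a \<otimes>\<^bsub>W\<^esub> (if t then b' else a'), b \<otimes>\<^bsub>W\<^esub> (if t then a' else b'), t \<noteq> t')),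
     one = (\<one>\<^bsub>W\<^esub>, \<one>\<^bsub>W\<^esub>, False)\<rparr>"

lemma swap_wreath_simps:
  "carrier (swap_wreath W) = carrier W \<times> carrier W \<times> UNIV"
  "(a, b, t) \<otimes>\<^bsub>swap_wreath W\<^esub> (a', b', t') =
    (a \<otimes>\<^bsub>W\<^esub> (if t then b' else a'), b \<otimes>\<^bsub>W\<^esub> (if t then a' else b'), t \<noteq> t')"
  "\<one>\<^bsub>swap_wreath W\<^esub> = (\<one>\<^bsub>W\<^esub>, \<one>\<^bsub>W\<^esub>, False)"
  by (simp_all add: swap_wreath_def)

context group
begin

lemma group_swap_wreath: "group (swap_wreath G)"
proof (rule groupI)
  fix x assume "x \<in> carrier (swap_wreath G)"
  then obtain a b t where x: "x = (a, b, t)" "a \<in> carrier G" "b \<in> carrier G"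
    by (auto simp: swap_wreath_simps)
  then show "\<exists>y\<in>carrier (swap_wreath G). y \<otimes>\<^bsub>swap_wreath G\<^esub> x = \<one>\<^bsub>swap_wreath G\<^esub>"
    by (intro bexI[of _ "if t then (inv b, inv a, t) else (inv a, inv b, t)"]) (auto simp: swap_wreath_simps)
qed (auto simp: swap_wreath_simps m_assoc)

lemma inv_swap_wreath:
  assumes "a \<in> carrier G" "b \<in> carrier G"
  shows "inv\<^bsub>swap_wreath G\<^esub> (a, b, t) = (if t then (inv b, inv a, t) else (inv a, inv b, t))"
  using assms by (intro group.inv_equality[OF group_swap_wreath]) (auto simp: swap_wreath_simps)

lemma commutator_base:
  assumes "a \<in> carrier G" "b \<in> carrier G" "a' \<in> carrier G" "b' \<in> carrier G"
  shows "(a, b, False) \<otimes>\<^bsub>swap_wreath G\<^esub> (a', b', False) \<otimes>\<^bsub>swap_wreath G\<^esub>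
      inv\<^bsub>swap_wreath G\<^esub> (a, b, False) \<otimes>\<^bsub>swap_wreath G\<^esub> inv\<^bsub>swap_wreath G\<^esub> (a', b', False) =
    (a \<otimes> a' \<otimes> inv a \<otimes> inv a', b \<otimes> b' \<otimes> inv b \<otimes> inv b', False)"
  using assms by (simp add: swap_wreath_simps inv_swap_wreath)

lemma subgroup_base:
  assumes "subgroup S G"
  shows "subgroup (S \<times> S \<times> {False}) (swap_wreath G)"
proof -
  have S: "S \<subseteq> carrier G" using assms by (rule subgroup.subset)
  show ?thesis
  proof (rule group.subgroupI[OF group_swap_wreath])
    show "S \<times> S \<times> {False} \<subseteq> carrier (swap_wreath G)" using S by (auto simp: swap_wreath_simps)
    show "S \<times> S \<times> {False} \<noteq> {}" using subgroup.one_closed[OF assms] by blast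
    fix x y assume "x \<in> S \<times> S \<times> {False}" "y \<in> S \<times> S \<times> {False}"
    then obtain a b a' b' where "x = (a, b, False)" "y = (a', b', False)" "a \<in> S" "b \<in> S" "a' \<in> S" "b' \<in> S"
      by blast
    then show "inv\<^bsub>swap_wreath G\<^esub> x \<in> S \<times> S \<times> {False}"
      "x \<otimes>\<^bsub>swap_wreath G\<^esub> y \<in> S \<times> S \<times> {False}"
      using S assms by (simp_all add: swap_wreath_simps inv_swap_wreath subsetD subgroup.m_closed subgroup.m_inv_closed)
  qed
qed

lemma subgroup_fst_base:
  assumes K: "subgroup K (swap_wreath G)"
  shows "subgroup {x. \<exists>y. (x, y, False) \<in> K} G"
proof -
  have sub: "K \<subseteq> carrier (swap_wreath G)" using K by (rule subgroup.subset)
  show ?thesis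
  proof (rule subgroupI)
    show "{x. \<exists>y. (x, y, False) \<in> K} \<subseteq> carrier G" using sub by (auto simp: swap_wreath_simps)
    show "{x. \<exists>y. (x, y, False) \<in> K} \<noteq> {}" using subgroup.one_closed[OF K] by (auto simp: swap_wreath_simps)
    show "inv a \<in> {x. \<exists>y. (x, y, False) \<in> K}" if a: "a \<in> {x. \<exists>y. (x, y, False) \<in> K}" for a
    proof -
      obtain b where b: "(a, b, False) \<in> K" using a by blast
      moreover have "a \<in> carrier G" "b \<in> carrier G" using b sub by (auto simp: swap_wreath_simps)
      ultimately show ?thesis
        using subgroup.m_inv_closed[OF K b] inv_swap_wreath[of a b False] by auto
    qed
    show "a \<otimes> a' \<in> {x. \<exists>y. (x, y, False) \<in> K}"
      if a: "a \<in> {x. \<exists>y. (x, y, False) \<in> K}" "a' \<in> {x. \<exists>y. (x, y, False) \<in> K}" for a a'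
    proof -
      obtain b b' where "(a, b, False) \<in> K" "(a', b', False) \<in> K" using a by blast
      then have "(a, b, False) \<otimes>\<^bsub>swap_wreath G\<^esub> (a', b', False) \<in> K" by (rule subgroup.m_closed[OF K])
      then show ?thesis by (auto simp: swap_wreath_simps)
    qed
  qed
qed

text \<open>The quotient by the base group has order 2, so the first commutators land in the base;
  there commutators are formed componentwise. Hence the index shift by one.\<close>

lemma derived_swap_wreath_upper:
  "(derived (swap_wreath G) ^^ Suc k) (carrier (swap_wreath G)) \<subseteq>
    (derived G ^^ k) (carrier G) \<times> (derived G ^^ k) (carrier G) \<times> {False}"
proof (induction k)
  case 0
  interpret V: group "swap_wreath G" by (rule group_swap_wreath)
  have "x \<otimes>\<^bsub>swap_wreath G\<^esub> y \<otimes>\<^bsub>swap_wreath G\<^esub> inv\<^bsub>swap_wreath G\<^esub> x \<otimes>\<^bsub>swap_wreath G\<^esub> inv\<^bsub>swap_wreath G\<^esub> y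
      \<in> carrier G \<times> carrier G \<times> {False}"
    if "x \<in> carrier (swap_wreath G)" "y \<in> carrier (swap_wreath G)" for x y
  proof -
    obtain a b t a' b' t' where xy: "x = (a, b, t)" "y = (a', b', t')" by (metis prod_cases3)
    then have "a \<in> carrier G" "b \<in> carrier G" "a' \<in> carrier G" "b' \<in> carrier G"
      using that by (auto simp: swap_wreath_simps)
    then show ?thesis unfolding xy by (cases t; cases t') (simp_all add: swap_wreath_simps inv_swap_wreath)
  qed
  then have "derived_set (swap_wreath G) (carrier (swap_wreath G)) \<subseteq> carrier G \<times> carrier G \<times> {False}"
    by blast
  then show ?case
    using V.generate_subgroup_incl[OF _ subgroup_base[OF subgroup_self]] by (simp add: derived_def)
next
  case (Suc k)
  interpret V: group "swap_wreath G" by (rule group_swap_wreath)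
  let ?S = "(derived G ^^ k) (carrier G)"
  have S: "?S \<subseteq> carrier G" by (rule exp_of_derived_in_carrier) simp
  have "derived_set (swap_wreath G) (?S \<times> ?S \<times> {False}) \<subseteq> derived G ?S \<times> derived G ?S \<times> {False}"
  proof
    fix c assume "c \<in> derived_set (swap_wreath G) (?S \<times> ?S \<times> {False})"
    then obtain a b a' b' where ab: "a \<in> ?S" "b \<in> ?S" "a' \<in> ?S" "b' \<in> ?S"
      and c: "c = (a, b, False) \<otimes>\<^bsub>swap_wreath G\<^esub> (a', b', False) \<otimes>\<^bsub>swap_wreath G\<^esub>
        inv\<^bsub>swap_wreath G\<^esub> (a, b, False) \<otimes>\<^bsub>swap_wreath G\<^esub> inv\<^bsub>swap_wreath G\<^esub> (a', b', False)"
      by blast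
    then have "c = (a \<otimes> a' \<otimes> inv a \<otimes> inv a', b \<otimes> b' \<otimes> inv b \<otimes> inv b', False)"
      using S commutator_base[of a b a' b'] by blast
    then show "c \<in> derived G ?S \<times> derived G ?S \<times> {False}"
      using commutator_in_derived[OF ab(1,3), of G] commutator_in_derived[OF ab(2,4), of G] by simp
  qed
  then have "derived (swap_wreath G) (?S \<times> ?S \<times> {False}) \<subseteq> derived G ?S \<times> derived G ?S \<times> {False}"
    unfolding derived_def[of "swap_wreath G"]
    by (rule V.generate_subgroup_incl[OF _ subgroup_base[OF derived_is_subgroup[OF S]]])
  then show ?case using V.mono_derived[OF Suc] by auto
qed

text \<open>The commutator of \<open>(x, \<one>, False)\<close> with the swap is
  \<open>(x, inv x, False)\<close>, so the first derived subgroup already projects onto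
  \<open>G\<close>. Commutators in the base project to commutators, which keeps the first projection
  large at every later step.\<close>

lemma derived_swap_wreath_lower:
  "(derived G ^^ k) (carrier G) \<subseteq>
    {x. \<exists>y. (x, y, False) \<in> (derived (swap_wreath G) ^^ Suc k) (carrier (swap_wreath G))}"
proof (induction k)
  case 0
  have "(x, inv x, False) \<in> derived (swap_wreath G) (carrier (swap_wreath G))" if x: "x \<in> carrier G" for x
  proof -
    have "(x, \<one>, False) \<in> carrier (swap_wreath G)" "(\<one>, \<one>, True) \<in> carrier (swap_wreath G)"
      using x by (auto simp: swap_wreath_simps)
    from commutator_in_derived[OF this, of "swap_wreath G"] show ?thesis
      using x by (simp add: swap_wreath_simps inv_swap_wreath)
  qed
  then show ?case by auto
next
  case (Suc k)
  interpret V: group "swap_wreath G" by (rule group_swap_wreath)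
  let ?D = "(derived (swap_wreath G) ^^ Suc k) (carrier (swap_wreath G))"
  let ?S = "(derived G ^^ k) (carrier G)"
  have D: "?D \<subseteq> carrier (swap_wreath G)" by (rule V.exp_of_derived_in_carrier) simp
  have "derived_set G ?S \<subseteq> {x. \<exists>y. (x, y, False) \<in> derived (swap_wreath G) ?D}"
  proof
    fix c assume "c \<in> derived_set G ?S"
    then obtain a a' where a: "a \<in> ?S" "a' \<in> ?S" "c = a \<otimes> a' \<otimes> inv a \<otimes> inv a'" by blast
    then obtain b b' where b: "(a, b, False) \<in> ?D" "(a', b', False) \<in> ?D" using Suc by blast
    have "a \<in> carrier G" "b \<in> carrier G" "a' \<in> carrier G" "b' \<in> carrier G"
      using b D unfolding swap_wreath_simps by blast+
    then have "(c, b \<otimes> b' \<otimes> inv b \<otimes> inv b', False) \<in> derived (swap_wreath G) ?D"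
      using commutator_in_derived[OF b, of "swap_wreath G"] by (simp only: commutator_base a(3))
    then show "c \<in> {x. \<exists>y. (x, y, False) \<in> derived (swap_wreath G) ?D}" by blast
  qed
  then have "derived G ?S \<subseteq> {x. \<exists>y. (x, y, False) \<in> derived (swap_wreath G) ?D}"
    unfolding derived_def[of G]
    by (rule generate_subgroup_incl[OF _ subgroup_fst_base[OF V.derived_is_subgroup[OF D]]])
  then show ?case by simp
qed

text \<open>\<open>swap_wreath\<close> changes the element type. A copy on the natural numbers lets
  an induction iterate it within one type.\<close>

lemma copy_on_nat:
  assumes "finite (carrier G)"
  obtains W :: "nat monoid" and f where "group_hom G W f" "inj_on f (carrier G)" "f ` carrier G = carrier W"
proof -
  obtain f :: "'a \<Rightarrow> nat" where f: "inj_on f (carrier G)"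
    using finite_imp_inj_to_nat_seg[OF assms] by blast
  have "group_hom G (image_group f G) f"
    using inj_imp_image_group_iso[OF f] inj_imp_image_group_is_group[OF f] is_group
    by (simp add: group_hom_def group_hom_axioms_def iso_def)
  then show thesis using that f image_group_carrier by metis
qed

end

text \<open>Starting from the trivial group, each wreath product with a group of order 2 raises the
  derived length by exactly one and keeps the order a power of 2.\<close>

lemma exists_two_group_derived_length:
  "\<exists>W :: nat monoid. group W \<and> finite (carrier W) \<and> (\<exists>k. card (carrier W) = 2 ^ k) \<and>
    (derived W ^^ n) (carrier W) = {\<one>\<^bsub>W\<^esub>} \<and> (\<forall>i<n. (derived W ^^ i) (carrier W) \<noteq> {\<one>\<^bsub>W\<^esub>})"
proof (induction n)
  case 0
  let ?W = "\<lparr>carrier = {0}, monoid.mult = (\<lambda>x y. 0), one = 0\<rparr> :: nat monoid"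
  have "group ?W" by (rule groupI) auto
  then show ?case by (intro exI[of _ ?W]) (auto intro: exI[of _ 0])
next
  case (Suc n)
  then obtain W :: "nat monoid" and k where W: "group W" "finite (carrier W)" "card (carrier W) = 2 ^ k"
    "(derived W ^^ n) (carrier W) = {\<one>\<^bsub>W\<^esub>}" "\<forall>i<n. (derived W ^^ i) (carrier W) \<noteq> {\<one>\<^bsub>W\<^esub>}" by blast
  interpret W: group W by (rule W(1))
  interpret V: group "swap_wreath W" by (rule W.group_swap_wreath)
  let ?V = "swap_wreath W"
  have fin: "finite (carrier ?V)" using W(2) by (simp add: swap_wreath_simps)
  have card: "card (carrier ?V) = 2 ^ (2 * k + 1)"
    using W(3) by (simp add: swap_wreath_simps card_cartesian_product UNIV_bool power_add mult_2 distrib_left)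
  have top: "(derived ?V ^^ Suc n) (carrier ?V) = {\<one>\<^bsub>?V\<^esub>}"
    using W.derived_swap_wreath_upper[of n] W(4) subgroup.one_closed[OF V.exp_of_derived_is_subgroup[OF V.subgroup_self], of "Suc n"]
    by (auto simp: swap_wreath_simps)
  have ne: "(derived ?V ^^ i) (carrier ?V) \<noteq> {\<one>\<^bsub>?V\<^esub>}" if "i < Suc n" for i
  proof (cases i)
    \<comment> \<open>\<open>derived_swap_wreath_lower\<close> says nothing about index 0; the swap
      is a nontrivial element there.\<close>
    case 0
    have "(\<one>\<^bsub>W\<^esub>, \<one>\<^bsub>W\<^esub>, True) \<in> carrier ?V" by (simp add: swap_wreath_simps)
    then show ?thesis using 0 by (auto simp: swap_wreath_simps)
  next
    case (Suc j)
    then have "(derived W ^^ j) (carrier W) \<noteq> {\<one>\<^bsub>W\<^esub>}" using W(5) that by simp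
    moreover have "\<one>\<^bsub>W\<^esub> \<in> (derived W ^^ j) (carrier W)"
      by (rule subgroup.one_closed[OF W.exp_of_derived_is_subgroup[OF W.subgroup_self]])
    ultimately obtain x where "x \<in> (derived W ^^ j) (carrier W)" "x \<noteq> \<one>\<^bsub>W\<^esub>" by blast
    then obtain y where "(x, y, False) \<in> (derived ?V ^^ i) (carrier ?V)"
      using W.derived_swap_wreath_lower[of j] Suc by blast
    then show ?thesis using \<open>x \<noteq> \<one>\<^bsub>W\<^esub>\<close> by (auto simp: swap_wreath_simps)
  qed
  obtain U :: "nat monoid" and f where f: "group_hom ?V U f" "inj_on f (carrier ?V)" "f ` carrier ?V = carrier U"
    using V.copy_on_nat[OF fin] by blast
  interpret f: group_hom ?V U f by (rule f(1))
  have img: "(derived U ^^ i) (carrier U) = f ` (derived ?V ^^ i) (carrier ?V)" for i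
    using f.exp_of_derived_img[of "carrier ?V" i] f(3) by simp
  have "(derived U ^^ i) (carrier U) = {\<one>\<^bsub>U\<^esub>} \<longleftrightarrow> (derived ?V ^^ i) (carrier ?V) = {\<one>\<^bsub>?V\<^esub>}" for i
  proof -
    have "(derived ?V ^^ i) (carrier ?V) \<subseteq> carrier ?V" by (rule V.exp_of_derived_in_carrier) simp
    then have "f ` (derived ?V ^^ i) (carrier ?V) = f ` {\<one>\<^bsub>?V\<^esub>} \<longleftrightarrow> (derived ?V ^^ i) (carrier ?V) = {\<one>\<^bsub>?V\<^esub>}"
      by (intro inj_on_image_eq_iff[OF f(2)]) auto
    then show ?thesis by (simp add: img)
  qed
  moreover have "finite (carrier U)" using fin f(3) by (metis finite_imageI)
  moreover have "card (carrier U) = 2 ^ (2 * k + 1)" using card card_image[OF f(2)] f(3) by metis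
  ultimately show ?case using top ne f.H.is_group by (intro exI[of _ U]) blast
qed

section \<open>The three families of Bieberbach groups\<close>

lemma exists_Bieberbach_derived_length:
  assumes "l \<ge> 2"
  shows "\<exists>G. Bieberbach_group G \<and> finite_generalized_exponent G \<and> solvable G \<and> derived_length G = l"
proof -
  \<comment> \<open>\<open>Suc m\<close> is the derived length of the 2-group \<open>Q\<close>; the
    lattice adds one more step, giving \<open>m + 2\<close>.\<close>
  define m where "m = l - 2"
  obtain Q :: "nat monoid" and k where Q: "group Q" "finite (carrier Q)" "card (carrier Q) = 2 ^ k"
    "(derived Q ^^ Suc m) (carrier Q) = {\<one>\<^bsub>Q\<^esub>}" "\<forall>i<Suc m. (derived Q ^^ i) (carrier Q) \<noteq> {\<one>\<^bsub>Q\<^esub>}"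
    using exists_two_group_derived_length[of "Suc m"] by blast
  interpret Q: group Q by (rule Q(1))
  have "carrier Q \<noteq> {\<one>\<^bsub>Q\<^esub>}" using Q(5)[rule_format, of 0] by simp
  then obtain z where "inverting_group Q z" using Q.inverting_group_if_two_group Q(2,3) by blast
  then interpret I: inverting_group Q z .
  let ?P = "Q \<times>\<times> C2"
  interpret P: group ?P by (rule I.group_prod)
  interpret pr1: group_hom ?P Q fst by (rule DirProd_fst_hom) (simp_all add: Q.is_group)
  interpret pr2: group_hom ?P C2 snd by (rule DirProd_snd_hom) (simp_all add: Q.is_group)
  have img1: "fst ` (derived ?P ^^ i) (carrier ?P) = (derived Q ^^ i) (carrier Q)" for i
    using pr1.exp_of_derived_img[of "carrier ?P" i] by (simp add: carrier_C2)
  \<comment> \<open>\<open>C2\<close> is abelian and \<open>Suc m\<close> is positive, so the extra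
    factor does not lengthen the derived series.\<close>
  have "derived C2 (carrier C2) = {0}"
    using comm_group.derived_eq_singleton[OF abelian_integer_mod_group, of "carrier C2" 2] by simp
  then have "(derived C2 ^^ Suc m) (carrier C2) = {0}"
    using group.exp_of_derived_one[OF group_integer_mod_group, of 1 2 "carrier C2" "Suc m"] by simp
  then have img2: "snd ` (derived ?P ^^ Suc m) (carrier ?P) = {0}"
  proof -
    have "snd ` carrier ?P = carrier C2" using Q.one_closed by force
    then show ?thesis
      using pr2.exp_of_derived_img[of "carrier ?P" "Suc m"] \<open>(derived C2 ^^ Suc m) (carrier C2) = {0}\<close>
      by (metis subset_refl)
  qed
  have "(derived ?P ^^ Suc m) (carrier ?P) \<subseteq> {\<one>\<^bsub>?P\<^esub>}"
  proof
    fix x assume "x \<in> (derived ?P ^^ Suc m) (carrier ?P)"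
    then have "fst x \<in> {\<one>\<^bsub>Q\<^esub>}" "snd x \<in> {0}" using img1[of "Suc m"] img2 Q(4) by blast+
    then show "x \<in> {\<one>\<^bsub>?P\<^esub>}" by (cases x) simp
  qed
  then have top: "(derived ?P ^^ Suc m) (carrier ?P) = {\<one>\<^bsub>?P\<^esub>}"
    using subgroup.one_closed[OF P.exp_of_derived_is_subgroup[OF P.subgroup_self]] by blast
  have sub: "subgroup ((derived ?P ^^ m) (carrier ?P)) ?P"
    by (rule P.exp_of_derived_is_subgroup[OF P.subgroup_self])
  have "(derived ?P ^^ m) (carrier ?P) \<noteq> {\<one>\<^bsub>?P\<^esub>}"
  proof
    assume "(derived ?P ^^ m) (carrier ?P) = {\<one>\<^bsub>?P\<^esub>}"
    then have "(derived Q ^^ m) (carrier Q) = {\<one>\<^bsub>Q\<^esub>}" using img1[of m] by simp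
    then show False using Q(5) by blast
  qed
  then obtain x where x: "x \<in> (derived ?P ^^ m) (carrier ?P)" "x \<noteq> \<one>\<^bsub>?P\<^esub>"
    using subgroup.one_closed[OF sub] by blast
  have xc: "x \<in> carrier ?P" using x(1) subgroup.subset[OF sub] by blast
  have card: "card (carrier ?P) = 2 ^ (k + 1)" using Q(3) by (simp add: card_cartesian_product carrier_C2)
  \<comment> \<open>The last nontrivial derived subgroup contains an involution: a power of any of
    its nontrivial elements.\<close>
  obtain j :: nat where j: "x [^]\<^bsub>?P\<^esub> j \<noteq> \<one>\<^bsub>?P\<^esub>" "x [^]\<^bsub>?P\<^esub> j \<otimes>\<^bsub>?P\<^esub> x [^]\<^bsub>?P\<^esub> j = \<one>\<^bsub>?P\<^esub>"
    using P.exists_power_involution[OF xc x(2) card] by blast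
  have "x [^]\<^bsub>?P\<^esub> i \<in> (derived ?P ^^ m) (carrier ?P)" for i :: nat
    by (induction i) (use x(1) subgroup.one_closed[OF sub] subgroup.m_closed[OF sub] in auto)
  then obtain G where "Bieberbach_group G" "finite_generalized_exponent G" "solvable G" "derived_length G = m + 2"
    using I.exists_Bieberbach top j by metis
  then show ?thesis using assms by (auto simp: m_def)
qed

lemma exists_Bieberbach_large_exponent:
  "\<exists>G. Bieberbach_group G \<and> finite_generalized_exponent G \<and> N \<le> generalized_exponent G"
proof -
  \<comment> \<open>A generator of this cyclic group forces its order \<open>2 ^ Suc N\<close>,
    which exceeds \<open>N\<close>, to divide every generalized period of a group mapping onto
    it.\<close>
  let ?Q = "integer_mod_group (2 ^ Suc N)"
  interpret Q: comm_group ?Q by (rule abelian_integer_mod_group)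
  have Q: "carrier ?Q = {0..<2 ^ Suc N}" by (simp add: carrier_integer_mod_group)
  have "(1::int) < 2 ^ Suc N" by (rule one_less_power) simp_all
  then have "1 \<in> carrier ?Q" using Q by auto
  then have "carrier ?Q \<noteq> {\<one>\<^bsub>?Q\<^esub>}" by (metis one_integer_mod_group singletonD zero_neq_one)
  moreover have "card (carrier ?Q) = 2 ^ Suc N" "finite (carrier ?Q)"
    unfolding Q by (simp_all add: nat_power_eq nat_mult_distrib)
  ultimately obtain z where "inverting_group ?Q z"
    using Q.inverting_group_if_two_group by blast
  then interpret I: inverting_group ?Q z .
  let ?P = "?Q \<times>\<times> C2"
  obtain G f where G: "Bieberbach_group G" "finite_generalized_exponent G"
    and f: "group_hom G ?P f" "f ` carrier G = carrier ?P"
    by (rule I.exists_Bieberbach)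
  interpret f: group_hom G ?P f by (rule f(1))
  interpret pr: group_hom ?P ?Q fst by (rule DirProd_fst_hom) (simp_all add: Q.is_group)
  interpret fst_f: group_hom G ?Q "fst \<circ> f"
    using group_hom.axioms(2)[OF f(1)] f.homh pr.homh
    by (simp add: group_hom_def group_hom_axioms_def f.G.is_group Q.is_group hom_compose)
  have "(1, 0) \<in> carrier ?P" using \<open>1 \<in> carrier ?Q\<close> by (simp add: carrier_C2)
  then obtain x where x: "x \<in> carrier G" "f x = (1, 0)" using f(2) by (metis imageE)
  have "is_generalized_period G (generalized_exponent G)"
    using G(2) unfolding generalized_exponent_def finite_generalized_exponent_def by (rule LeastI_ex)
  then have k: "generalized_exponent G > 0" "(fst \<circ> f) x [^]\<^bsub>?Q\<^esub> generalized_exponent G = \<one>\<^bsub>?Q\<^esub>"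
    using fst_f.pow_eq_one_if_generalized_period[OF Q.comm_group_axioms _ x(1)]
    by (auto simp: is_generalized_period_def)
  then have "2 ^ Suc N dvd int (generalized_exponent G)" using x(2) by (simp add: mod_eq_0_iff_dvd)
  then have "2 ^ Suc N dvd generalized_exponent G" by (metis int_dvd_int_iff of_nat_numeral of_nat_power)
  then have "2 ^ Suc N \<le> generalized_exponent G" using k(1) by (rule dvd_imp_le)
  moreover have "N \<le> 2 ^ Suc N" using less_exp[of "Suc N"] by simp
  ultimately show ?thesis using G by (meson le_trans)
qed

lemma exists_Bieberbach_not_solvable:
  "\<exists>G. Bieberbach_group G \<and> finite_generalized_exponent G \<and> \<not> solvable G"
proof -
  let ?Q = "sym_group 5"
  interpret Q: group ?Q by (rule sym_group_is_group)
  obtain z where "inverting_group ?Q z" using inverting_group_sym_group[of 5] by auto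
  then interpret I: inverting_group ?Q z .
  let ?P = "?Q \<times>\<times> C2"
  obtain G f where G: "Bieberbach_group G" "finite_generalized_exponent G"
    and f: "group_hom G ?P f" "f ` carrier G = carrier ?P"
    by (rule I.exists_Bieberbach)
  interpret f: group_hom G ?P f by (rule f(1))
  interpret pr: group_hom ?P ?Q fst by (rule DirProd_fst_hom) (simp_all add: Q.is_group)
  have "\<not> solvable G"
  proof
    \<comment> \<open>Solvability passes to images, first along \<open>f\<close> and then to the
      symmetric group of degree 5.\<close>
    assume "solvable G"
    then have "solvable_seq ?Q (fst ` f ` carrier G)"
      unfolding solvable_def by (intro pr.solvable_imp_solvable_img f.solvable_imp_solvable_img)
    then have "solvable ?Q" unfolding f(2) by (simp add: solvable_def carrier_C2)
    then show False using sym_group_is_unsolvable[of 5] by simp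
  qed
  then show ?thesis using G by blast
qed

theorem corollary3p4:
  shows
    "(\<forall>l::nat. l \<ge> 2 \<longrightarrow>
        (\<exists>G. Bieberbach_group G \<and> finite_generalized_exponent G \<and>
             solvable G \<and> derived_length G = l)) \<and>
     (\<forall>N::nat. N > 0 \<longrightarrow>
        (\<exists>G. Bieberbach_group G \<and> finite_generalized_exponent G \<and>
             N \<le> generalized_exponent G)) \<and>
     (\<exists>G. Bieberbach_group G \<and> finite_generalized_exponent G \<and> \<not> solvable G)"
  using exists_Bieberbach_derived_length exists_Bieberbach_large_exponent exists_Bieberbach_not_solvable
  by blast

end
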